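(* Let $\Gamma$ be a countably infinite discrete group. If $B\subseteq\mathrm{Free}(2^\Gamma)$ is a Borel complete section, then there exists $n\in\mathbb{N}$ such that for every finite set $F\subset\Gamma$ of size at least $n$, the set $F\cdot B$ traps a point.
   Context: The space $2^\Gamma$ of functions $x:\Gamma\to\{0,1\}$ has the product topology and the shift action $(\gamma\cdot x)(\delta)=x(\delta\gamma)$. $\mathrm{Free}(2^\Gamma)$ is the set of all points $x\in 2^\Gamma$ with trivial stabilizer; it is a shift-invariant $G_\delta$ subset of $2^\Gamma$. A complete section in $\mathrm{Free}(2^\Gamma)$ is a subset $B\subseteq\mathrm{Free}(2^\Gamma)$ that meets every $\Gamma$-orbit, i.e., $\Gamma\cdot B=\mathrm{Free}(2^\Gamma)$. For $F\subseteq\Gamma$, $F\cdot B=\{\sigma\cdot b:\sigma\in F,\ b\in B\}$. A set $A\subseteq\mathrm{Free}(2^\Gamma)$ traps a point $x\in\mathrm{Free}(2^\Gamma)$ if $\Gamma\cdot x\subseteq A$; "$A$ traps a point" means it traps some $x\in\mathrm{Free}(2^\Gamma)$. *)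

theory Defs
  imports "HOL-Analysis.Analysis" "HOL-Algebra.Group_Action"
begin

text \<open>The space of functions from the group to \<^typ>\<open>bool\<close> (standing for the two-point set);
  elements of the product space are extensional, i.e. undefined outside the carrier.\<close>

definition shift_space :: "('a, 'b) monoid_scheme \<Rightarrow> ('a \<Rightarrow> bool) topology" where
  "shift_space G = product_topology (\<lambda>_. discrete_topology UNIV) (carrier G)"

text \<open>Restricted to the space, as \<^const>\<open>group_action\<close> requires of an action.\<close>

definition shift :: "('a, 'b) monoid_scheme \<Rightarrow> 'a \<Rightarrow> ('a \<Rightarrow> bool) \<Rightarrow> ('a \<Rightarrow> bool)" where
  "shift G \<gamma> = (\<lambda>x\<in>topspace (shift_space G). \<lambda>\<delta>\<in>carrier G. x (\<delta> \<otimes>\<^bsub>G\<^esub> \<gamma>))"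

definition free_part :: "('a, 'b) monoid_scheme \<Rightarrow> ('a \<Rightarrow> bool) set" where
  "free_part G = {x \<in> topspace (shift_space G). stabilizer G (shift G) x = {\<one>\<^bsub>G\<^esub>}}"

definition translates ::
  "('a, 'b) monoid_scheme \<Rightarrow> 'a set \<Rightarrow> ('a \<Rightarrow> bool) set \<Rightarrow> ('a \<Rightarrow> bool) set" where
  "translates G F B = {shift G \<sigma> b | \<sigma> b. \<sigma> \<in> F \<and> b \<in> B}"

definition complete_section :: "('a, 'b) monoid_scheme \<Rightarrow> ('a \<Rightarrow> bool) set \<Rightarrow> bool" where
  "complete_section G B \<longleftrightarrow> B \<subseteq> free_part G \<and> translates G (carrier G) B = free_part G"

definition traps :: "('a, 'b) monoid_scheme \<Rightarrow> ('a \<Rightarrow> bool) set \<Rightarrow> ('a \<Rightarrow> bool) \<Rightarrow> bool" where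
  "traps G A x \<longleftrightarrow> x \<in> free_part G \<and> orbit G (shift G) x \<subseteq> A"

definition borel_sets_of :: "'a topology \<Rightarrow> 'a set set" where
  "borel_sets_of X = sigma_sets (topspace X) {U. openin X U}"

lemma topspace_shift_space: "topspace (shift_space G) = carrier G \<rightarrow>\<^sub>E UNIV"
  by (simp add: shift_space_def)

lemma (in group) shift_closed:
  "x \<in> topspace (shift_space G) \<Longrightarrow> shift G g x \<in> topspace (shift_space G)"
  by (auto simp: topspace_shift_space shift_def)

lemma (in group) shift_mult:
  assumes "g \<in> carrier G" "h \<in> carrier G" "x \<in> topspace (shift_space G)"
  shows "shift G (g \<otimes> h) x = shift G g (shift G h x)"
  using assms shift_closed[OF assms(3), of h]
  by (auto simp: shift_def m_assoc fun_eq_iff)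

lemma (in group) shift_one:
  assumes "x \<in> topspace (shift_space G)"
  shows "shift G \<one> x = x"
  using assms by (auto simp: shift_def fun_eq_iff topspace_shift_space PiE_def extensional_def)

lemma (in group) shift_group_action: "group_action G (topspace (shift_space G)) (shift G)"
proof -
  let ?X = "topspace (shift_space G)"
  have bij: "shift G g \<in> Bij ?X" if g: "g \<in> carrier G" for g
  proof -
    have "bij_betw (shift G g) ?X ?X"
    proof (rule bij_betw_byWitness[where f' = "shift G (inv g)"])
      show "\<forall>x\<in>?X. shift G (inv g) (shift G g x) = x"
        using g by (metis inv_closed l_inv shift_mult shift_one)
      show "\<forall>x\<in>?X. shift G g (shift G (inv g) x) = x"
        using g by (metis inv_closed r_inv shift_mult shift_one)
    qed (auto intro: shift_closed)
    then show ?thesis by (auto simp: Bij_def shift_def)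
  qed
  have "shift G \<in> hom G (BijGroup ?X)"
  proof (rule homI)
    fix g h assume gh: "g \<in> carrier G" "h \<in> carrier G"
    have "shift G (g \<otimes> h) x = compose ?X (shift G g) (shift G h) x" for x
      using gh by (cases "x \<in> ?X") (simp_all add: compose_def shift_mult, simp add: shift_def)
    then have "shift G (g \<otimes> h) = compose ?X (shift G g) (shift G h)" by (rule ext)
    then show "shift G (g \<otimes> h) = shift G g \<otimes>\<^bsub>BijGroup ?X\<^esub> shift G h"
      using gh bij by (simp add: BijGroup_def)
  qed (simp add: BijGroup_def bij)
  then show ?thesis
    unfolding group_action_def group_hom_def group_hom_axioms_def
    using group_BijGroup is_group by blast
qed

end

theory Submission
  imports Defs "HOL-Real_Asymp.Real_Asymp"
begin

text \<open>
  Write \<open>[t]\<close> for the cylinder of points that extend a finite pattern \<open>t\<close>. The group translates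
  of \<open>B\<close> cover the free part, so by Baire category \<open>B\<close> contains the generic points of some
  \<open>[t]\<close>, where \<open>t\<close> may be taken to be nonempty. A point \<open>x\<close> would be trapped by \<open>F \<cdot> B\<close> if
  all its translates were generic and every \<open>d \<cdot> x\<close> lay in \<open>F \<cdot> [t]\<close>. But the points with the second property form a nowhere dense closed
  set, and for the product topology a generic point has no such recurrence. The remedy is to
  make invariant closed sets of this kind open as well, that is, to do category with respect to a
  forcing whose conditions \<open>(t, \<T>)\<close> consist of a finite pattern \<open>t\<close> and a description \<open>\<T>\<close> of
  a subshift: a right-invariant family of finite patterns, standing for the points that have
  arbitrarily large finite restrictions in \<open>\<T>\<close> (\<open>locally_in\<close>), with \<open>t \<in> \<T>\<close>.

  For this to work, a condition \<open>(t, \<T>)\<close> must allow, for every large \<open>F\<close>, a smaller subshift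
  all of whose points \<open>x\<close> satisfy \<open>d \<cdot> x \<in> F \<cdot> [t]\<close> for every \<open>d\<close>, and the smaller subshift must be
  as good as the first, since the construction is repeated after further extensions of
  \<open>t\<close>. The notion that passes through this induction is \<open>admissible\<close>: possibly infinitely many
  members of \<open>\<T>\<close> with disjoint neighbourhoods can be planted at once in a point of the
  subshift, which moreover has arbitrarily large restrictions in \<open>\<T>\<close> that cut through no
  prescribed blocks. The full family of patterns is admissible, and \<open>admissible_refine\<close> is the
  inductive step. The smaller family \<open>refine \<T> C t E r\<close> consists of the members of \<open>\<T>\<close> which,
  for every \<open>d\<close>, contain a copy of \<open>t\<close> at one of the places \<open>e d\<close> with \<open>e \<in> E\<close>, or leave at least \<open>r\<close>
  of these places untouched. To plant its members one plants them as members of \<open>\<T>\<close>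
  together with many copies of \<open>t\<close>. The positions of the copies form a sparse set that meets a
  system of sets of size about \<open>r\<close>, each place being in only polynomially many of them
  (\<open>hitting_set\<close>). Such a set exists by the Lovasz local lemma; \<open>n\<close> is the size from
  which on \<open>F\<close> contains a sparse set with \<open>r\<^sup>2\<close> elements, where \<open>r\<close> depends on \<open>(t, \<T>)\<close> only.

  The rest is a generic argument. There are countably many conditions, every Borel set
  is decided by densely many of them (\<open>decided_borel\<close>), and there are free points all of whose
  translates are generic (\<open>fully_generic_exists\<close>). Hence some
  \<open>(t, \<T>)\<close> forces membership in \<open>B\<close> (\<open>section_forced\<close>). For large \<open>F\<close> take a generic point
  of the subshift refined for \<open>t\<close> and the inverses of elements of \<open>F\<close>: each translate of it is carried
  into \<open>[t]\<close>, hence into \<open>B\<close>, by the inverse of an element of \<open>F\<close>.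
\<close>

section \<open>A local lemma for isolated points\<close>

text \<open>
  Tychonoff's theorem: a constraint that depends on finitely many coordinates cuts out a closed
  subset of the compact space of all sets.
\<close>
lemma local_compactness:
  fixes U :: "'i \<Rightarrow> 'v set" and good :: "'i \<Rightarrow> 'v set \<Rightarrow> bool"
  assumes fin: "\<And>i. i \<in> I \<Longrightarrow> finite (U i)"
    and local: "\<And>i A. i \<in> I \<Longrightarrow> good i A \<longleftrightarrow> good i (A \<inter> U i)"
    and sol: "\<And>S. finite S \<Longrightarrow> \<exists>A. \<forall>i\<in>I. U i \<subseteq> S \<longrightarrow> good i A"
  shows "\<exists>A. \<forall>i\<in>I. good i A"
proof -
  let ?X = "product_topology (\<lambda>_::'v. discrete_topology (UNIV::bool set)) UNIV"
  let ?C = "\<lambda>i. {x. good i {v. x v}}"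
  have comp: "compact_space ?X"
    by (simp add: compact_space_product_topology compact_space_discrete_topology)
  have open_patt: "openin ?X {x. \<forall>v\<in>W. x v = p v}" if "finite W" for W p
  proof -
    have "{x. \<forall>v\<in>W. x v = p v} = (\<Pi>\<^sub>E v\<in>UNIV. if v \<in> W then {p v} else UNIV)"
      by (auto simp: PiE_def Pi_def)
    moreover have "finite {v \<in> UNIV. (if v \<in> W then {p v} else UNIV) \<noteq> (UNIV::bool set)}"
      by (rule finite_subset[OF _ that]) auto
    ultimately show ?thesis
      by (auto simp: openin_PiE_gen)
  qed
  have closed: "closedin ?X (?C i)" if i: "i \<in> I" for i
  proof -
    have "openin ?X (- ?C i)"
    proof (subst openin_subopen, intro ballI)
      fix x assume x: "x \<in> - ?C i"
      have "{y. \<forall>v\<in>U i. y v = x v} \<subseteq> - ?C i"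
      proof
        fix y assume "y \<in> {y. \<forall>v\<in>U i. y v = x v}"
        then have "{v. y v} \<inter> U i = {v. x v} \<inter> U i" by auto
        then show "y \<in> - ?C i"
          using x local[OF i, of "{v. y v}"] local[OF i, of "{v. x v}"] by auto
      qed
      then show "\<exists>T. openin ?X T \<and> x \<in> T \<and> T \<subseteq> - ?C i"
        using open_patt[OF fin[OF i], of x] by blast
    qed
    then show ?thesis
      by (simp add: closedin_def Compl_eq_Diff_UNIV)
  qed
  have "\<Inter>(?C ` I) \<noteq> {}"
  proof (cases "I = {}")
    case False
    have "\<Inter>\<F> \<noteq> {}" if \<F>: "finite \<F>" "\<F> \<subseteq> ?C ` I" for \<F>
    proof -
      obtain J where J: "finite J" "J \<subseteq> I" "\<F> = ?C ` J"
        using \<F> by (meson finite_subset_image)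
      have "finite (\<Union>(U ` J))" using J fin by blast
      then obtain A where "\<forall>i\<in>I. U i \<subseteq> \<Union>(U ` J) \<longrightarrow> good i A"
        using sol by blast
      then have "(\<lambda>v. v \<in> A) \<in> \<Inter>\<F>" using J by auto
      then show ?thesis by blast
    qed
    then show ?thesis
      using comp closed unfolding compact_space_fip by (metis (mono_tags, lifting) imageE)
  qed simp
  then obtain x where "x \<in> \<Inter>(?C ` I)" by blast
  then show ?thesis by auto
qed

text \<open>
  For a uniformly random set \<open>A\<close> and fixed \<open>H\<close> the \<open>q\<close> events \<open>A \<inter> N h = {h}\<close> are independent of
  probability \<open>2\<^sup>-\<^sup>l\<close> each, so all of them fail with probability \<open>(1 - 2\<^sup>-\<^sup>l)\<^sup>q\<close>. This is the setting
  of the local lemma. The proof is Rosenfeld's counting argument: the number of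
  partial solutions on a finite set \<open>S\<close> grows by a factor of at least \<open>\<beta>\<close> with every new point. Of
  the two ways to extend a partial solution, the gap \<open>2 - \<beta>\<close> pays for those that violate a constraint.
\<close>
lemma isolated_hitting_set:
  fixes N :: "'v \<Rightarrow> 'v set" and \<H> :: "'v set set" and \<beta> :: real
  assumes \<H>: "\<And>H. H \<in> \<H> \<Longrightarrow> finite H \<and> card H = q"
    and N: "\<And>H h. H \<in> \<H> \<Longrightarrow> h \<in> H \<Longrightarrow> h \<in> N h \<and> finite (N h) \<and> card (N h) = l"
    and disj: "\<And>H. H \<in> \<H> \<Longrightarrow> disjoint_family_on N H"
    and deg: "\<And>v. finite {H \<in> \<H>. v \<in> \<Union>(N ` H)} \<and> card {H \<in> \<H>. v \<in> \<Union>(N ` H)} \<le> m"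
    and q: "0 < q"
    and \<beta>: "0 < \<beta>" "real m * (2 ^ l - 1) ^ q \<le> (2 - \<beta>) * \<beta> ^ (l * q - 1)"
  shows "\<exists>A. \<forall>H\<in>\<H>. \<exists>h\<in>H. A \<inter> N h = {h}"
proof -
  define U where "U H = \<Union>(N ` H)" for H
  define good where "good H A \<longleftrightarrow> (\<exists>h\<in>H. A \<inter> N h = {h})" for H A
  have finU: "finite (U H)" and cardU: "card (U H) = l * q" if "H \<in> \<H>" for H
  proof -
    show "finite (U H)" using \<H>[OF that] N[OF that] by (auto simp: U_def)
    have "card (U H) = (\<Sum>h\<in>H. card (N h))"
      unfolding U_def using \<H>[OF that] N[OF that] disj[OF that]
      by (intro card_UN_disjoint) (auto simp: disjoint_family_on_def)
    then show "card (U H) = l * q" using \<H>[OF that] N[OF that] by simp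
  qed
  have local: "good H A \<longleftrightarrow> good H (A \<inter> U H)" for H A
  proof -
    have "A \<inter> U H \<inter> N h = A \<inter> N h" if "h \<in> H" for h
      using that by (auto simp: U_def)
    then show ?thesis by (simp add: good_def)
  qed
  define bad where "bad H = {P. P \<subseteq> U H \<and> \<not> good H P}" for H
  have card_bad: "real (card (bad H)) \<le> (2 ^ l - 1) ^ q" and fin_bad: "finite (bad H)"
    if H: "H \<in> \<H>" for H
  proof -
    let ?T = "\<Pi>\<^sub>E h\<in>H. Pow (N h) - {{h}}"
    let ?f = "\<lambda>P. \<lambda>h\<in>H. P \<inter> N h"
    show "finite (bad H)"
      by (rule finite_subset[of _ "Pow (U H)"]) (auto simp: bad_def finU[OF H])
    have inj: "inj_on ?f (bad H)"
    proof (rule inj_onI)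
      fix P Q assume PQ: "P \<in> bad H" "Q \<in> bad H" "?f P = ?f Q"
      then have "P \<inter> N h = Q \<inter> N h" if "h \<in> H" for h
        using that by (metis restrict_apply')
      then show "P = Q" using PQ by (auto simp: bad_def U_def) blast+
    qed
    have "?f ` bad H \<subseteq> ?T" by (auto simp: bad_def good_def)
    moreover have "finite ?T" using \<H>[OF H] N[OF H] by (intro finite_PiE) auto
    ultimately have "card (bad H) \<le> card ?T"
      using inj by (intro card_inj_on_le[of ?f])
    also have "card ?T = (\<Prod>h\<in>H. card (Pow (N h) - {{h}}))"
      using \<H>[OF H] by (simp add: card_PiE)
    also have "\<dots> = (\<Prod>h\<in>H. 2 ^ l - 1)"
      using N[OF H] by (intro prod.cong) (auto simp: card_Diff_singleton card_Pow)
    also have "\<dots> = (2 ^ l - 1) ^ q" using \<H>[OF H] by simp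
    finally have "real (card (bad H)) \<le> real ((2 ^ l - 1) ^ q)" by linarith
    then show "real (card (bad H)) \<le> (2 ^ l - 1) ^ q" by (simp add: of_nat_diff)
  qed
  define c where "c S = {A. A \<subseteq> S \<and> (\<forall>H\<in>\<H>. U H \<subseteq> S \<longrightarrow> good H A)}" for S
  have fin_c: "finite (c S)" if "finite S" for S
    by (rule finite_subset[of _ "Pow S"]) (auto simp: c_def that)
  have restrict: "A \<inter> T \<in> c T" if "A \<in> c S" "T \<subseteq> S" for A S T
  proof -
    have "good H (A \<inter> T)" if "H \<in> \<H>" "U H \<subseteq> T" for H
    proof -
      have "good H A" using \<open>A \<in> c S\<close> \<open>T \<subseteq> S\<close> that by (auto simp: c_def)
      moreover have "A \<inter> T \<inter> U H = A \<inter> U H" using that by auto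
      ultimately show ?thesis using local by metis
    qed
    then show ?thesis by (auto simp: c_def)
  qed
  have growth: "\<beta> * real (card (c S)) \<le> real (card (c (insert v S)))"
    if "finite S" "v \<notin> S" for S v
    using that
  proof (induction "card S" arbitrary: S v rule: less_induct)
    case less
    have mono: "\<beta> ^ card (S - T) * real (card (c T)) \<le> real (card (c S))" if "T \<subseteq> S" for T
    proof -
      have "\<beta> ^ card R * real (card (c T)) \<le> real (card (c (T \<union> R)))"
        if "finite R" "T \<union> R \<subseteq> S" "T \<inter> R = {}" for R
        using that
      proof (induction R rule: finite_induct)
        case (insert a R)
        have "finite (T \<union> R)"
          by (rule finite_subset[OF _ less.prems(1)]) (use insert.prems in auto)
        have a: "a \<notin> T \<union> R" "a \<in> S" using insert by auto
        have "card (T \<union> R) < card S"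
          using a insert.prems less.prems(1) by (intro psubset_card_mono) auto
        then have "\<beta> * real (card (c (T \<union> R))) \<le> real (card (c (insert a (T \<union> R))))"
          using less.hyps[of "T \<union> R" a] \<open>finite (T \<union> R)\<close> a by auto
        moreover have "\<beta> ^ card R * real (card (c T)) \<le> real (card (c (T \<union> R)))"
          using insert by auto
        then have "\<beta> * (\<beta> ^ card R * real (card (c T))) \<le> \<beta> * real (card (c (T \<union> R)))"
          using \<beta>(1) by (intro mult_left_mono) auto
        ultimately show ?case using insert.hyps by (simp add: mult.assoc)
      qed simp
      from this[of "S - T"] show ?thesis
        using less.prems(1) that by (simp add: Un_absorb1)
    qed
    \<comment> \<open>All constraints that can become violated by the new point \<open>v\<close>.\<close>
    define \<K> where "\<K> = {H \<in> \<H>. v \<in> U H \<and> U H \<subseteq> insert v S}"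
    have fin\<K>: "finite \<K>" and card\<K>: "card \<K> \<le> m"
    proof -
      have sub: "\<K> \<subseteq> {H \<in> \<H>. v \<in> \<Union>(N ` H)}" by (auto simp: \<K>_def U_def)
      then show "finite \<K>" using deg finite_subset by blast
      show "card \<K> \<le> m" using sub deg[of v] by (meson card_mono le_trans)
    qed
    define bd where "bd H = {A. A \<subseteq> insert v S \<and> A \<inter> S \<in> c S \<and> \<not> good H A}" for H
    define all where "all = {A. A \<subseteq> insert v S \<and> A \<inter> S \<in> c S}"
    have fin_all: "finite all"
      by (rule finite_subset[of _ "Pow (insert v S)"]) (auto simp: all_def less.prems(1))
    have card_all: "card all = 2 * card (c S)"
    proof -
      have "all = c S \<union> insert v ` c S"
      proof (intro equalityI subsetI)
        fix A assume A: "A \<in> all"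
        show "A \<in> c S \<union> insert v ` c S"
        proof (cases "v \<in> A")
          case True
          then have "A = insert v (A \<inter> S)" using A by (auto simp: all_def)
          then show ?thesis using A by (auto simp: all_def)
        next
          case False
          then have "A = A \<inter> S" using A by (auto simp: all_def)
          then show ?thesis using A by (auto simp: all_def)
        qed
      next
        fix A assume "A \<in> c S \<union> insert v ` c S"
        then show "A \<in> all"
        proof
          assume "A \<in> c S"
          moreover have "A \<inter> S = A" using \<open>A \<in> c S\<close> by (auto simp: c_def)
          ultimately show ?thesis by (auto simp: all_def c_def)
        next
          assume "A \<in> insert v ` c S"
          then obtain A' where A': "A' \<in> c S" "A = insert v A'" by blast
          then have "A \<inter> S = A'" using less.prems(2) by (auto simp: c_def)
          then show ?thesis using A' by (auto simp: all_def c_def)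
        qed
      qed
      moreover have "c S \<inter> insert v ` c S = {}" using less.prems(2) by (auto simp: c_def)
      moreover have "inj_on (insert v) (c S)"
        using less.prems(2) by (auto simp: inj_on_def c_def)
      ultimately show ?thesis
        using fin_c[OF less.prems(1)] by (simp add: card_Un_disjoint card_image)
    qed
    have cover: "all \<subseteq> c (insert v S) \<union> (\<Union>H\<in>\<K>. bd H)"
    proof
      fix A assume A: "A \<in> all"
      show "A \<in> c (insert v S) \<union> (\<Union>H\<in>\<K>. bd H)"
      proof (cases "A \<in> c (insert v S)")
        case False
        then obtain H where H: "H \<in> \<H>" "U H \<subseteq> insert v S" "\<not> good H A"
          using A by (auto simp: all_def c_def)
        have "v \<in> U H"
        proof (rule ccontr)
          assume "v \<notin> U H"
          then have "U H \<subseteq> S" using H by auto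
          then have "good H (A \<inter> S)" "A \<inter> S \<inter> U H = A \<inter> U H"
            using A H by (auto simp: all_def c_def)
          then show False using local H(3) by metis
        qed
        then show ?thesis using A H by (auto simp: \<K>_def bd_def all_def)
      qed auto
    qed
    have bd: "real (card (bd H)) * \<beta> ^ (l * q - 1) \<le> (2 ^ l - 1) ^ q * real (card (c S))"
      and fin_bd: "finite (bd H)" if H: "H \<in> \<K>" for H
    proof -
      have H': "H \<in> \<H>" "v \<in> U H" "U H \<subseteq> insert v S" using H by (auto simp: \<K>_def)
      show "finite (bd H)"
        by (rule finite_subset[OF _ fin_all]) (auto simp: bd_def all_def)
      \<comment> \<open>A set violating \<open>H\<close> is determined by its bad trace on \<open>U H\<close> and by a partial solution on
        \<open>S - U H\<close>; the induction hypothesis, applied \<open>l * q - 1\<close> times, bounds the number of the latter.\<close>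
      let ?f = "\<lambda>A. (A \<inter> U H, A \<inter> S \<inter> (S - U H))"
      have "inj_on ?f (bd H)"
      proof (rule inj_onI)
        fix A A' assume A: "A \<in> bd H" "A' \<in> bd H" and eq: "?f A = ?f A'"
        have "B = (B \<inter> U H) \<union> (B \<inter> S \<inter> (S - U H))" if "B \<in> bd H" for B
          using that H'(2) by (auto simp: bd_def)
        then show "A = A'" using A eq by (metis prod.inject)
      qed
      moreover have "?f ` bd H \<subseteq> bad H \<times> c (S - U H)"
      proof
        fix z assume "z \<in> ?f ` bd H"
        then obtain A where A: "A \<in> bd H" "z = ?f A" by blast
        have "A \<inter> U H \<in> bad H"
          using A(1) local[of H A] unfolding bd_def bad_def by blast
        moreover have "A \<inter> S \<inter> (S - U H) \<in> c (S - U H)"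
          using A(1) by (intro restrict[of "A \<inter> S" S]) (auto simp: bd_def)
        ultimately show "z \<in> bad H \<times> c (S - U H)" using A(2) by blast
      qed
      moreover have "finite (bad H \<times> c (S - U H))"
        using fin_bad[OF H'(1)] fin_c[of "S - U H"] less.prems(1) by blast
      ultimately have "card (bd H) \<le> card (bad H \<times> c (S - U H))"
        by (rule card_inj_on_le)
      then have "real (card (bd H)) \<le> real (card (bad H)) * real (card (c (S - U H)))"
        by (metis card_cartesian_product of_nat_le_iff of_nat_mult)
      also have "\<dots> \<le> (2 ^ l - 1) ^ q * real (card (c (S - U H)))"
        using card_bad[OF H'(1)] by (intro mult_right_mono) auto
      finally have 1: "real (card (bd H)) * \<beta> ^ (l * q - 1)
          \<le> (2 ^ l - 1) ^ q * real (card (c (S - U H))) * \<beta> ^ (l * q - 1)"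
        using \<beta>(1) by (intro mult_right_mono) auto
      have "S - (S - U H) = U H - {v}" using H' less.prems(2) by auto
      then have "card (S - (S - U H)) = l * q - 1"
        using cardU[OF H'(1)] finU[OF H'(1)] H'(2) by simp
      with mono[of "S - U H"] have "real (card (c (S - U H))) * \<beta> ^ (l * q - 1) \<le> real (card (c S))"
        by (simp add: mult.commute)
      then have "(2 ^ l - 1) ^ q * (real (card (c (S - U H))) * \<beta> ^ (l * q - 1))
          \<le> (2 ^ l - 1) ^ q * real (card (c S))"
        by (intro mult_left_mono) auto
      with 1 show "real (card (bd H)) * \<beta> ^ (l * q - 1) \<le> (2 ^ l - 1) ^ q * real (card (c S))"
        by (simp add: mult.assoc)
    qed
    have "2 * card (c S) \<le> card (c (insert v S) \<union> (\<Union>H\<in>\<K>. bd H))"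
      unfolding card_all[symmetric] using cover fin_c[of "insert v S"] less.prems(1) fin\<K> fin_bd
      by (intro card_mono) auto
    also have "\<dots> \<le> card (c (insert v S)) + card (\<Union>H\<in>\<K>. bd H)"
      by (rule card_Un_le)
    also have "card (\<Union>H\<in>\<K>. bd H) \<le> (\<Sum>H\<in>\<K>. card (bd H))"
      by (rule card_UN_le[OF fin\<K>])
    finally have total: "2 * real (card (c S))
        \<le> real (card (c (insert v S))) + (\<Sum>H\<in>\<K>. real (card (bd H)))"
      by (simp flip: of_nat_sum of_nat_add)
    have pos: "\<beta> ^ (l * q - 1) > 0" using \<beta>(1) by simp
    have "(\<Sum>H\<in>\<K>. real (card (bd H))) * \<beta> ^ (l * q - 1)
        \<le> (\<Sum>H\<in>\<K>. (2 ^ l - 1) ^ q * real (card (c S)))"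
      unfolding sum_distrib_right by (rule sum_mono) (rule bd)
    also have "\<dots> = real (card \<K>) * ((2 ^ l - 1) ^ q * real (card (c S)))" by simp
    also have "\<dots> \<le> real m * ((2 ^ l - 1) ^ q * real (card (c S)))"
      using card\<K> by (intro mult_right_mono) auto
    also have "\<dots> = (real m * (2 ^ l - 1) ^ q) * real (card (c S))" by simp
    also have "\<dots> \<le> ((2 - \<beta>) * \<beta> ^ (l * q - 1)) * real (card (c S))"
      using \<beta>(2) by (intro mult_right_mono) auto
    finally have "(\<Sum>H\<in>\<K>. real (card (bd H))) * \<beta> ^ (l * q - 1)
        \<le> ((2 - \<beta>) * real (card (c S))) * \<beta> ^ (l * q - 1)"
      by (simp add: mult_ac)
    then have "(\<Sum>H\<in>\<K>. real (card (bd H))) \<le> (2 - \<beta>) * real (card (c S))"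
      using pos by (simp add: mult_le_cancel_right)
    with total show ?case by (simp add: algebra_simps)
  qed
  have pos: "card (c S) > 0" if "finite S" for S
    using that
  proof (induction S rule: finite_induct)
    case empty
    have "U H \<noteq> {}" if "H \<in> \<H>" for H
    proof
      assume *: "U H = {}"
      have "H = {}" using N[OF that] * by (auto simp: U_def)
      then have "q = 0" using \<H>[OF that] by simp
      then show False using q by simp
    qed
    then have "c {} = {{}}" by (auto simp: c_def)
    then show ?case by simp
  next
    case (insert v S)
    then have "0 < \<beta> * real (card (c S))" using \<beta>(1) by simp
    also have "\<dots> \<le> real (card (c (insert v S)))" using growth insert by blast
    finally show ?case by simp
  qed
  have "\<exists>A. \<forall>H\<in>\<H>. good H A"
  proof (rule local_compactness)
    fix S :: "'v set" assume "finite S"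
    then have "c S \<noteq> {}" using pos[of S] by auto
    then show "\<exists>A. \<forall>H\<in>\<H>. U H \<subseteq> S \<longrightarrow> good H A" by (auto simp: c_def)
  qed (use finU in blast, rule local)
  then show ?thesis by (simp add: good_def)
qed

section \<open>Sparse hitting sets in a group\<close>

text \<open>
  With \<open>\<beta>\<^sup>l\<close> strictly between \<open>2\<^sup>l - 1\<close> and \<open>2\<^sup>l\<close> the quotient of the two powers decays exponentially in
  \<open>r\<close>, which beats the polynomial factor.
\<close>
lemma hitting_parameters:
  fixes l k :: nat
  assumes "l > 0"
  shows "\<exists>r>k. \<exists>\<beta>>0. real (l * r ^ 3) * (2 ^ l - 1) ^ (r - k)
           \<le> (2 - \<beta>) * \<beta> ^ (l * (r - k) - 1)"
proof -
  define b :: real where "b = 2 ^ l - 1 / 2"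
  define \<beta> where "\<beta> = root l b"
  define \<rho> where "\<rho> = (2 ^ l - 1) / b"
  have two: "(2::real) \<le> 2 ^ l" using assms by (cases l) auto
  have b: "b > 0" "b < 2 ^ l" "2 ^ l - 1 < b" using two by (auto simp: b_def)
  have \<beta>: "\<beta> > 0" "\<beta> ^ l = b" using assms b by (auto simp: \<beta>_def)
  have "\<beta> < 2"
    using \<beta> b by (metis not_less less_eq_real_def power_mono zero_le_numeral)
  have \<rho>: "0 < \<rho>" "\<rho> < 1" using b two by (auto simp: \<rho>_def)
  have "(\<lambda>q. real (l * (q + k) ^ 3) * \<rho> ^ q) \<longlonglongrightarrow> 0"
    using \<rho> by real_asymp
  then have "\<forall>\<^sub>F q in sequentially. real (l * (q + k) ^ 3) * \<rho> ^ q < (2 - \<beta>) / 2"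
    using \<open>\<beta> < 2\<close> by (intro order_tendstoD) auto
  then obtain q where q: "q > 0" "real (l * (q + k) ^ 3) * \<rho> ^ q < (2 - \<beta>) / 2"
    using eventually_conj[OF _ eventually_gt_at_top[of 0]]
    by (metis (no_types, lifting) eventually_sequentially eventually_conj eventually_gt_at_top le_refl)
  have pw: "b ^ q = \<beta> * \<beta> ^ (l * q - 1)"
  proof -
    have "b ^ q = \<beta> ^ (l * q)" by (simp add: power_mult \<beta>)
    also have "l * q = Suc (l * q - 1)" using assms q by simp
    finally show ?thesis by simp
  qed
  have "real (l * (q + k) ^ 3) * (2 ^ l - 1) ^ q = real (l * (q + k) ^ 3) * \<rho> ^ q * b ^ q"
    using b by (simp add: \<rho>_def power_divide)
  also have "\<dots> \<le> (2 - \<beta>) / 2 * b ^ q"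
    using q b by (intro mult_right_mono) auto
  also have "\<dots> = (2 - \<beta>) * (\<beta> / 2) * \<beta> ^ (l * q - 1)" by (simp add: pw)
  also have "\<dots> \<le> (2 - \<beta>) * 1 * \<beta> ^ (l * q - 1)"
    using \<open>\<beta> < 2\<close> \<beta> by (intro mult_right_mono mult_left_mono) auto
  finally have "real (l * (q + k) ^ 3) * (2 ^ l - 1) ^ q \<le> (2 - \<beta>) * \<beta> ^ (l * q - 1)" by simp
  then show ?thesis
    using q \<beta> by (intro exI[of _ "q + k"] conjI exI[of _ \<beta>]) auto
qed

text \<open>
  Greedy choice: each chosen point excludes at most \<open>d\<close> points.
\<close>
lemma separated_subset:
  fixes R :: "'a \<Rightarrow> 'a set"
  assumes d: "0 < d"
    and R: "\<And>x. x \<in> F \<Longrightarrow> x \<in> R x \<and> finite (R x) \<and> card (R x) \<le> d"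
    and sym: "\<And>x y. x \<in> F \<Longrightarrow> y \<in> F \<Longrightarrow> y \<in> R x \<Longrightarrow> x \<in> R y"
    and F: "finite F" "N * d \<le> card F"
  shows "\<exists>E\<subseteq>F. card E = N \<and> (\<forall>x\<in>E. \<forall>y\<in>E. x \<noteq> y \<longrightarrow> y \<notin> R x)"
proof -
  have "\<exists>E\<subseteq>F'. card E = N \<and> (\<forall>x\<in>E. \<forall>y\<in>E. x \<noteq> y \<longrightarrow> y \<notin> R x)"
    if "F' \<subseteq> F" "N * d \<le> card F'" for F'
    using that
  proof (induction N arbitrary: F')
    case 0
    show ?case by (rule exI[of _ "{}"]) simp
  next
    case (Suc N)
    have finF': "finite F'" using Suc.prems(1) F(1) finite_subset by blast
    have "card F' > 0" using Suc.prems(2) d by (metis add_gr_0 mult_Suc order_less_le_trans)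
    then obtain x where x: "x \<in> F'" by fastforce
    then have Rx: "x \<in> R x" "finite (R x)" "card (R x) \<le> d" using R Suc.prems(1) by auto
    have "N * d \<le> card F' - card (R x)" using Suc.prems(2) Rx(3) by simp
    also have "\<dots> \<le> card (F' - R x)" by (rule diff_card_le_card_Diff[OF Rx(2)])
    finally have "N * d \<le> card (F' - R x)" .
    moreover have "F' - R x \<subseteq> F" using Suc.prems(1) by blast
    ultimately obtain E where E: "E \<subseteq> F' - R x" "card E = N"
        and sep: "\<forall>x\<in>E. \<forall>y\<in>E. x \<noteq> y \<longrightarrow> y \<notin> R x"
      using Suc.IH by metis
    have "x \<notin> E" using E(1) Rx(1) by blast
    moreover have "finite E" using E(1) finF' by (meson finite_Diff finite_subset)
    ultimately have "card (insert x E) = Suc N" using E(2) by simp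
    moreover have "y \<notin> R x \<and> x \<notin> R y" if "y \<in> E" for y
    proof -
      have "y \<notin> R x" "y \<in> F" "x \<in> F" using that E(1) Suc.prems(1) x by auto
      then show ?thesis using sym by blast
    qed
    ultimately show ?case
      using E(1) x sep by (intro exI[of _ "insert x E"]) blast
  qed
  then show ?thesis using F(2) by blast
qed

context group begin

lemma card_translate:
  assumes "H \<subseteq> carrier G" "g \<in> carrier G"
  shows "card (H #> g) = card H"
proof -
  have "H #> g = (\<lambda>h. h \<otimes> g) ` H" by (auto simp: r_coset_def)
  moreover have "inj_on (\<lambda>h. h \<otimes> g) H" using assms by (intro inj_onI) (auto dest: right_cancel[THEN iffD1, rotated -1])
  ultimately show ?thesis by (simp add: card_image)
qed

text \<open>
  The sets of \<open>fam d\<close> are the requirements attached to \<open>d\<close>, each asking for a point of \<open>\<Delta>\<close> in some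
  part of \<open>E d\<close>. They are cut down to exactly \<open>r - k\<close> elements, and \<open>\<Delta>\<close> consists of the points of a random set
  that are isolated in their \<open>L\<close>-neighbourhoods. A group element is in the \<open>L\<close>-neighbourhood
  of at most \<open>\<bar>L\<bar> r\<^sup>2\<close> translates \<open>E d\<close>, so it takes part in at most \<open>\<bar>L\<bar> r\<^sup>3\<close> requirements. The slack \<open>k\<close>
  makes up for a bounded number of forbidden places. The size \<open>r\<^sup>2\<close> of \<open>E\<close> leaves room for \<open>r\<close>
  disjoint requirements of size \<open>r\<close>.
\<close>
lemma hitting_set:
  assumes L: "finite L" "L \<subseteq> carrier G" "\<one> \<in> L"
  shows "\<exists>r>k. \<forall>E fam. E \<subseteq> carrier G \<longrightarrow> finite E \<longrightarrow> card E = r * r \<longrightarrow>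
           disjoint_family_on (\<lambda>e. L #> e) E \<longrightarrow>
           (\<forall>d\<in>carrier G. finite (fam d) \<and> card (fam d) \<le> r \<and>
              (\<forall>H\<in>fam d. H \<subseteq> E #> d \<and> r \<le> card H + k)) \<longrightarrow>
           (\<exists>\<Delta>. \<Delta> \<subseteq> (\<Union>d\<in>carrier G. \<Union>(fam d)) \<and>
              (\<forall>d\<in>carrier G. \<forall>H\<in>fam d. H \<inter> \<Delta> \<noteq> {}) \<and>
              (\<forall>p\<in>\<Delta>. \<forall>p'\<in>\<Delta>. p' \<in> L #> p \<longrightarrow> p' = p))"
proof -
  define l where "l = card L"
  have "l > 0" using L by (auto simp: l_def card_gt_0_iff)
  from hitting_parameters[OF this, of k] obtain r and \<beta> :: real where r: "r > k" and \<beta>: "\<beta> > 0"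
      "real (l * r ^ 3) * (2 ^ l - 1) ^ (r - k) \<le> (2 - \<beta>) * \<beta> ^ (l * (r - k) - 1)"
    by blast
  show ?thesis
  proof (intro exI[of _ r] conjI allI impI)
    fix E fam
    assume E: "E \<subseteq> carrier G" "finite E" "card E = r * r"
      and sparse: "disjoint_family_on (\<lambda>e. L #> e) E"
      and fam: "\<forall>d\<in>carrier G. finite (fam d) \<and> card (fam d) \<le> r \<and>
              (\<forall>H\<in>fam d. H \<subseteq> E #> d \<and> r \<le> card H + k)"
    define pick where "pick H = (SOME H'. H' \<subseteq> H \<and> card H' = r - k)" for H :: "'a set"
    have pick: "pick H \<subseteq> H \<and> card (pick H) = r - k" if "d \<in> carrier G" "H \<in> fam d" for d H
    proof -
      have "r - k \<le> card H" using fam that by (simp add: le_diff_conv)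
      then have "\<exists>H'. H' \<subseteq> H \<and> card H' = r - k" by (meson obtain_subset_with_card_n)
      then show ?thesis unfolding pick_def by (rule someI_ex)
    qed
    define \<H> where "\<H> = (\<Union>d\<in>carrier G. pick ` fam d)"
    define N where "N p = L #> p" for p
    have fin: "finite (E #> d)" if "d \<in> carrier G" for d
      using E by (simp add: r_coset_def)
    have \<H>D: "\<exists>d\<in>carrier G. H \<subseteq> E #> d \<and> card H = r - k" if "H \<in> \<H>" for H
      using that pick fam unfolding \<H>_def by blast
    have sub: "H \<subseteq> carrier G" if "H \<in> \<H>" for H
      using \<H>D[OF that] E(1) r_coset_subset_G by blast
    have "\<exists>A. \<forall>H\<in>\<H>. \<exists>h\<in>H. A \<inter> N h = {h}"
    proof (rule isolated_hitting_set[where l = l and q = "r - k" and \<beta> = \<beta> and m = "l * r ^ 3"])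
      show "finite H \<and> card H = r - k" if "H \<in> \<H>" for H
        using \<H>D[OF that] fin finite_subset by blast
      show "h \<in> N h \<and> finite (N h) \<and> card (N h) = l" if "H \<in> \<H>" "h \<in> H" for H h
      proof -
        have h: "h \<in> carrier G" using sub that by blast
        have "h \<in> N h" using h L(3) by (force simp: N_def r_coset_def)
        then show ?thesis
          using L h by (auto simp: N_def l_def card_translate) (simp add: r_coset_def)
      qed
      show "disjoint_family_on N H" if H: "H \<in> \<H>" for H
      proof -
        obtain d where d: "d \<in> carrier G" "H \<subseteq> E #> d" using \<H>D[OF H] by blast
        show ?thesis
          unfolding disjoint_family_on_def
        proof (intro ballI impI)
          fix h h' assume h: "h \<in> H" "h' \<in> H" "h \<noteq> h'"
          have "h \<in> E #> d" "h' \<in> E #> d" using h d(2) by blast+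
          then obtain e e' where e: "e \<in> E" "e' \<in> E" "h = e \<otimes> d" "h' = e' \<otimes> d"
            unfolding r_coset_def by blast
          have ec: "e \<in> carrier G" "e' \<in> carrier G" "e \<noteq> e'" using e E h by auto
          have "(L #> e) \<inter> (L #> e') = {}"
            using sparse e ec by (simp add: disjoint_family_on_def)
          moreover have "a \<otimes> e \<in> (L #> e) \<inter> (L #> e')" if a: "a \<in> L" "a' \<in> L" "a \<otimes> h = a' \<otimes> h'" for a a'
          proof -
            have "a \<in> carrier G" "a' \<in> carrier G" using a L by auto
            then have "(a \<otimes> e) \<otimes> d = (a' \<otimes> e') \<otimes> d" using a(3) e ec d(1) by (simp add: m_assoc)
            then have "a \<otimes> e = a' \<otimes> e'"
              using \<open>a \<in> carrier G\<close> \<open>a' \<in> carrier G\<close> ec d(1) by simp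
            then show ?thesis using a unfolding r_coset_def by blast
          qed
          ultimately show "N h \<inter> N h' = {}" unfolding N_def r_coset_def by blast
        qed
      qed
      show "finite {H \<in> \<H>. v \<in> \<Union> (N ` H)} \<and> card {H \<in> \<H>. v \<in> \<Union> (N ` H)} \<le> l * r ^ 3" for v
      proof (cases "v \<in> carrier G")
        case False
        then have "{H \<in> \<H>. v \<in> \<Union> (N ` H)} = {}"
          using sub L by (auto simp: N_def r_coset_def subset_iff)
        then show ?thesis by (metis card.empty finite.emptyI le0)
      next
        case v: True
        \<comment> \<open>The \<open>d\<close> for which \<open>v\<close> is close to \<open>E d\<close>: solve \<open>v = a e d\<close>.\<close>
        let ?D = "(\<lambda>(a, e). inv (a \<otimes> e) \<otimes> v) ` (L \<times> E)"
        have D: "finite ?D" "card ?D \<le> l * (r * r)" "?D \<subseteq> carrier G"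
        proof -
          show "finite ?D" using L E by simp
          have "card ?D \<le> card (L \<times> E)" using L E by (intro card_image_le) simp
          then show "card ?D \<le> l * (r * r)" using E by (simp add: l_def card_cartesian_product)
          show "?D \<subseteq> carrier G"
            using L(2) E(1) v by (auto intro!: m_closed inv_closed simp: subset_iff)
        qed
        have "{H \<in> \<H>. v \<in> \<Union> (N ` H)} \<subseteq> (\<Union>d\<in>?D. pick ` fam d)"
        proof
          fix H assume "H \<in> {H \<in> \<H>. v \<in> \<Union> (N ` H)}"
          then obtain d H0 h where H: "d \<in> carrier G" "H0 \<in> fam d" "H = pick H0" "h \<in> H" "v \<in> N h"
            by (auto simp: \<H>_def)
          have "h \<in> E #> d" using H fam pick by blast
          then obtain e a where ea: "e \<in> E" "h = e \<otimes> d" "a \<in> L" "v = a \<otimes> h"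
            using H(5) unfolding N_def r_coset_def by blast
          have ec: "e \<in> carrier G" "a \<in> carrier G" using ea E L by auto
          then have "v = (a \<otimes> e) \<otimes> d" using ea H(1) by (simp add: m_assoc)
          then have "d = inv (a \<otimes> e) \<otimes> v"
            using ec H(1) by (simp add: inv_solve_left)
          then have "d \<in> ?D" using ea by (intro image_eqI[of _ _ "(a, e)"]) auto
          then show "H \<in> (\<Union>d\<in>?D. pick ` fam d)" using H by blast
        qed
        moreover have fin: "finite (\<Union>d\<in>?D. pick ` fam d)"
          using D fam by (intro finite_UN_I) auto
        moreover have "card (\<Union>d\<in>?D. pick ` fam d) \<le> l * r ^ 3"
        proof -
          have "card (\<Union>d\<in>?D. pick ` fam d) \<le> (\<Sum>d\<in>?D. card (pick ` fam d))"
            using D by (intro card_UN_le)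
          also have "\<dots> \<le> (\<Sum>d\<in>?D. r)"
            using D fam by (intro sum_mono) (meson card_image_le le_trans subsetD)
          also have "\<dots> \<le> l * (r * r) * r" using D by simp
          finally show ?thesis by (simp add: power3_eq_cube mult.assoc)
        qed
        ultimately show ?thesis by (meson card_mono finite_subset le_trans)
      qed
    qed (use r \<beta> in auto)
    then obtain A where A: "\<And>H. H \<in> \<H> \<Longrightarrow> \<exists>h\<in>H. A \<inter> N h = {h}" by blast
    let ?\<Delta> = "{p \<in> \<Union>\<H>. A \<inter> N p = {p}}"
    show "\<exists>\<Delta>. \<Delta> \<subseteq> (\<Union>d\<in>carrier G. \<Union>(fam d)) \<and>
              (\<forall>d\<in>carrier G. \<forall>H\<in>fam d. H \<inter> \<Delta> \<noteq> {}) \<and>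
              (\<forall>p\<in>\<Delta>. \<forall>p'\<in>\<Delta>. p' \<in> L #> p \<longrightarrow> p' = p)"
    proof (intro exI[of _ ?\<Delta>] conjI)
      show "?\<Delta> \<subseteq> (\<Union>d\<in>carrier G. \<Union>(fam d))" using pick by (auto simp: \<H>_def) blast
      show "\<forall>d\<in>carrier G. \<forall>H\<in>fam d. H \<inter> ?\<Delta> \<noteq> {}"
      proof (intro ballI)
        fix d H assume dH: "d \<in> carrier G" "H \<in> fam d"
        then have "pick H \<in> \<H>" by (auto simp: \<H>_def)
        then show "H \<inter> ?\<Delta> \<noteq> {}" using A[of "pick H"] pick[OF dH] by blast
      qed
      show "\<forall>p\<in>?\<Delta>. \<forall>p'\<in>?\<Delta>. p' \<in> L #> p \<longrightarrow> p' = p" by (auto simp: N_def)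
    qed
  qed (rule r)
qed

end

section \<open>Finite patterns and planting\<close>

lemma finite_meeting:
  assumes "disjoint_family_on f B" "finite W"
  shows "finite {b \<in> B. f b \<inter> W \<noteq> {}}"
proof -
  have "finite {b \<in> B. v \<in> f b}" for v
  proof (cases "\<exists>b\<in>B. v \<in> f b")
    case True
    then obtain b where "b \<in> B" "v \<in> f b" by blast
    then have "{b \<in> B. v \<in> f b} \<subseteq> {b}" using assms(1) by (auto simp: disjoint_family_on_def)
    then show ?thesis by (rule finite_subset) simp
  next
    case False
    then have "{b \<in> B. v \<in> f b} = {}" by blast
    then show ?thesis by (simp only: finite.emptyI)
  qed
  moreover have "{b \<in> B. f b \<inter> W \<noteq> {}} = (\<Union>v\<in>W. {b \<in> B. v \<in> f b})" by blast
  ultimately show ?thesis using assms(2) by simp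
qed

definition supp :: "('a \<times> bool) set \<Rightarrow> 'a set" where
  "supp t = fst ` t"

lemma suppI: "(v, b) \<in> t \<Longrightarrow> v \<in> supp t"
  by (force simp: supp_def)

lemma supp_mono: "s \<subseteq> t \<Longrightarrow> supp s \<subseteq> supp t"
  by (auto simp: supp_def)

text \<open>
  Patterns are finite graphs, so that extension is inclusion and a union of compatible patterns is a union of
  sets.
\<close>
definition graph_on :: "('a \<Rightarrow> bool) \<Rightarrow> 'a set \<Rightarrow> ('a \<times> bool) set" where
  "graph_on x W = (\<lambda>w. (w, x w)) ` W"

definition extends :: "('a \<Rightarrow> bool) \<Rightarrow> ('a \<times> bool) set \<Rightarrow> bool" where
  "extends x t \<longleftrightarrow> (\<forall>(w, b)\<in>t. x w = b)"

lemma supp_graph_on [simp]: "supp (graph_on x W) = W"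
  by (force simp: graph_on_def supp_def)

lemma extends_graph_on: "extends x (graph_on x W)"
  by (auto simp: extends_def graph_on_def)

lemma extendsD: "extends x t \<Longrightarrow> (v, b) \<in> t \<Longrightarrow> x v = b"
  by (auto simp: extends_def)

lemma extends_imp_eq:
  assumes "extends x t"
  shows "t = graph_on x (supp t)"
proof -
  have "(fst p, x (fst p)) = p" if "p \<in> t" for p
    using assms that by (cases p) (auto simp: extends_def)
  then show ?thesis by (simp add: graph_on_def supp_def image_image)
qed

lemma subset_graph_on: "t \<subseteq> graph_on x W \<longleftrightarrow> extends x t \<and> supp t \<subseteq> W"
  by (force simp: graph_on_def extends_def supp_def)

lemma extends_mono: "extends x t \<Longrightarrow> s \<subseteq> t \<Longrightarrow> extends x s"
  by (auto simp: extends_def)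

context group begin

lemma mem_set_mult: "v \<in> A <#> B \<longleftrightarrow> (\<exists>a\<in>A. \<exists>b\<in>B. v = a \<otimes> b)"
  by (auto simp: set_mult_def)

lemma mem_r_coset: "v \<in> A #> p \<longleftrightarrow> (\<exists>a\<in>A. v = a \<otimes> p)"
  by (auto simp: r_coset_def)

definition patterns :: "('a \<times> bool) set set" where
  "patterns = {graph_on x W | x W. finite W \<and> W \<subseteq> carrier G}"

text \<open>
  Translation is on the right because the shift acts by \<open>(g \<cdot> x) v = x (v g)\<close>: a point \<open>g \<cdot> x\<close> extends
  \<open>t\<close> exactly when \<open>x\<close> extends the translate of \<open>t\<close> by \<open>g\<close> (\<open>extends_shift\<close>). Neighbourhoods \<open>K A\<close> are
  formed on the left and commute with it.
\<close>
definition translate :: "('a \<times> bool) set \<Rightarrow> 'a \<Rightarrow> ('a \<times> bool) set" where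
  "translate t g = (\<lambda>(w, b). (w \<otimes> g, b)) ` t"

text \<open>
  The patterns in \<open>F\<close> are planted simultaneously. The sets in \<open>B\<close> are blocks that the
  restrictions of \<open>x\<close> to finite sets \<open>V\<close> must not cut through: the support of a copy planted inside a
  block is contained in \<open>V\<close> or disjoint from it, and these are the two alternatives of a refinement
  (\<open>refine\<close>). The hole \<open>w\<close> is a
  place left free on purpose: the inequality at \<open>w\<close> makes it possible to break the symmetry under any
  given \<open>g \<noteq> \<one>\<close>, which is the source of freeness.
\<close>
definition plantable :: "('a \<times> bool) set set \<Rightarrow> 'a set \<Rightarrow> bool" where
  "plantable \<T> K \<longleftrightarrow> (\<forall>F B w g.
     F \<subseteq> \<T> \<and> disjoint_family_on (\<lambda>s. K <#> supp s) F \<and>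
     (\<forall>b\<in>B. finite b \<and> b \<subseteq> carrier G) \<and> disjoint_family_on (\<lambda>b. K <#> b) B \<and>
     (\<forall>s\<in>F. \<exists>b\<in>B. K <#> supp s \<subseteq> b) \<and>
     w \<in> carrier G \<and> (\<forall>s\<in>F. w \<notin> supp s) \<and> g \<in> carrier G \<and> g \<noteq> \<one> \<longrightarrow>
     (\<exists>x. (\<forall>s\<in>F. extends x s) \<and> x (w \<otimes> g) \<noteq> x w \<and>
        (\<forall>W. finite W \<and> W \<subseteq> carrier G \<longrightarrow>
          (\<exists>V. finite V \<and> V \<subseteq> carrier G \<and> W \<subseteq> V \<and> graph_on x V \<in> \<T> \<and>
             (\<forall>b\<in>B. b \<inter> V \<noteq> {} \<longrightarrow> b \<subseteq> V)))))"

definition admissible :: "('a \<times> bool) set set \<Rightarrow> bool" where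
  "admissible \<T> \<longleftrightarrow> \<T> \<subseteq> patterns \<and> (\<forall>t\<in>\<T>. \<forall>g\<in>carrier G. translate t g \<in> \<T>) \<and>
     (\<exists>K. finite K \<and> K \<subseteq> carrier G \<and> \<one> \<in> K \<and> plantable \<T> K)"

text \<open>
  A finite pattern need not contain a copy of \<open>t\<close> for every \<open>d\<close>. The second alternative keeps
  \<open>r\<close> places open at which a copy can be planted later. If \<open>r > 0\<close> and \<open>\<one> \<in> C\<close>, it fails once
  the pattern covers all places \<open>e d\<close>, so points of the refined subshift have a copy for every \<open>d\<close> (\<open>refine_covers\<close>).
\<close>
definition refine ::
  "('a \<times> bool) set set \<Rightarrow> 'a set \<Rightarrow> ('a \<times> bool) set \<Rightarrow> 'a set \<Rightarrow> nat \<Rightarrow> ('a \<times> bool) set set" where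
  "refine \<T> C t E r = {s \<in> \<T>. \<forall>d\<in>carrier G.
     (\<exists>e\<in>E. translate t (e \<otimes> d) \<subseteq> s) \<or> r \<le> card {e \<in> E. (C #> (e \<otimes> d)) \<inter> supp s = {}}}"

lemma pattern_props:
  assumes "t \<in> patterns"
  shows "finite t" "finite (supp t)" "supp t \<subseteq> carrier G" "(v, b) \<in> t \<Longrightarrow> (v, b') \<in> t \<Longrightarrow> b = b'"
  using assms by (auto simp: patterns_def graph_on_def supp_def)

lemma supp_translate: "supp (translate t g) = supp t #> g"
  by (force simp: translate_def r_coset_def supp_def)

lemma translate_translate:
  assumes "supp t \<subseteq> carrier G" "g \<in> carrier G" "h \<in> carrier G"
  shows "translate (translate t g) h = translate t (g \<otimes> h)"
  using assms by (force simp: translate_def supp_def image_image m_assoc intro!: image_cong split: prod.splits)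

lemma translate_one:
  assumes "supp t \<subseteq> carrier G"
  shows "translate t \<one> = t"
proof -
  have "(\<lambda>(w, b). (w \<otimes> \<one>, b)) p = p" if "p \<in> t" for p
    using that assms by (cases p) (force dest: suppI)
  then show ?thesis by (simp add: translate_def)
qed

lemma translate_mono: "s \<subseteq> t \<Longrightarrow> translate s g \<subseteq> translate t g"
  by (auto simp: translate_def)

lemma translate_graph_on:
  assumes "W \<subseteq> carrier G" "g \<in> carrier G"
  shows "translate (graph_on x W) g = graph_on (\<lambda>v. x (v \<otimes> inv g)) (W #> g)"
proof -
  have "x (w \<otimes> g \<otimes> inv g) = x w" if "w \<in> W" for w
    using that assms by (simp add: m_assoc subset_iff)
  then show ?thesis
    by (force simp: translate_def graph_on_def r_coset_def)
qed

text \<open>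
  With no constraints, the planted patterns can be completed arbitrarily; the value at the hole \<open>w\<close> is
  chosen opposite to the value at \<open>w g\<close>. A finite set meets only finitely many of the
  disjoint blocks, and adding these makes it respect all of them.
\<close>
lemma admissible_patterns: "admissible patterns"
proof -
  have one: "{\<one>} <#> A = A" if "A \<subseteq> carrier G" for A
    using that by (force simp: set_mult_def)
  have "plantable patterns {\<one>}"
    unfolding plantable_def
  proof (intro allI impI, elim conjE)
    fix F B w g
    assume F: "F \<subseteq> patterns" and dF: "disjoint_family_on (\<lambda>s. {\<one>} <#> supp s) F"
      and B: "\<forall>b\<in>B. finite b \<and> b \<subseteq> carrier G" and dB: "disjoint_family_on (\<lambda>b. {\<one>} <#> b) B"
      and w: "w \<in> carrier G" "\<forall>s\<in>F. w \<notin> supp s" and g: "g \<in> carrier G" "g \<noteq> \<one>"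
    have dF': "supp s \<inter> supp s' = {}" if "s \<in> F" "s' \<in> F" "s \<noteq> s'" for s s'
    proof -
      have "{\<one>} <#> supp u = supp u" if "u \<in> F" for u
        using that F by (intro one pattern_props(3)) blast
      then show ?thesis using dF that by (simp add: disjoint_family_on_def)
    qed
    have dB': "disjoint_family_on (\<lambda>b. b) B"
      using dB B one by (simp add: disjoint_family_on_def)
    define y where "y v \<longleftrightarrow> (\<exists>s\<in>F. (v, True) \<in> s)" for v
    define x where "x v \<longleftrightarrow> (if v = w then \<not> y (w \<otimes> g) else y v)" for v
    have "extends x s" if s: "s \<in> F" for s
      unfolding extends_def
    proof (intro ballI, clarify)
      fix v b assume vb: "(v, b) \<in> s"
      then have "v \<noteq> w" using w s suppI by metis
      have "y v = b"
      proof (cases b)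
        case True
        then show ?thesis using vb s by (auto simp: y_def)
      next
        case False
        have "\<not> y v"
        proof
          assume "y v"
          then obtain s' where s': "s' \<in> F" "(v, True) \<in> s'" by (auto simp: y_def)
          then have "s' = s" using dF'[OF s s'(1)] vb suppI by (metis disjoint_iff)
          then show False using pattern_props(4) s' vb False F s by blast
        qed
        then show ?thesis using False by simp
      qed
      then show "x v = b" using \<open>v \<noteq> w\<close> by (simp add: x_def)
    qed
    moreover have "w \<otimes> g \<noteq> w" using w g by simp
    then have "x (w \<otimes> g) \<noteq> x w" by (simp add: x_def)
    moreover have "\<exists>V. finite V \<and> V \<subseteq> carrier G \<and> W \<subseteq> V \<and> graph_on x V \<in> patterns \<and>
             (\<forall>b\<in>B. b \<inter> V \<noteq> {} \<longrightarrow> b \<subseteq> V)" if W: "finite W" "W \<subseteq> carrier G" for W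
    proof -
      define V where "V = W \<union> \<Union>{b \<in> B. b \<inter> W \<noteq> {}}"
      have V: "finite V" "V \<subseteq> carrier G"
        using finite_meeting[OF dB' W(1)] B W by (auto simp: V_def)
      moreover have "b \<subseteq> V" if "b \<in> B" "b \<inter> V \<noteq> {}" for b
        using that dB' unfolding V_def disjoint_family_on_def by blast
      moreover have "graph_on x V \<in> patterns" using V unfolding patterns_def by blast
      moreover have "W \<subseteq> V" by (auto simp: V_def)
      ultimately show ?thesis by blast
    qed
    ultimately show "\<exists>x. (\<forall>s\<in>F. extends x s) \<and> x (w \<otimes> g) \<noteq> x w \<and>
        (\<forall>W. finite W \<and> W \<subseteq> carrier G \<longrightarrow>
          (\<exists>V. finite V \<and> V \<subseteq> carrier G \<and> W \<subseteq> V \<and> graph_on x V \<in> patterns \<and>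
             (\<forall>b\<in>B. b \<inter> V \<noteq> {} \<longrightarrow> b \<subseteq> V)))"
      by blast
  qed
  moreover have "translate t g \<in> patterns" if t: "t \<in> patterns" and "g \<in> carrier G" for t g
  proof -
    obtain x W where "t = graph_on x W" "finite W" "W \<subseteq> carrier G"
      using t unfolding patterns_def by blast
    moreover have "finite (W #> g)" "W #> g \<subseteq> carrier G"
      using calculation that by (auto simp: r_coset_def)
    ultimately show ?thesis using translate_graph_on[of W g x] that unfolding patterns_def by blast
  qed
  ultimately show ?thesis
    unfolding admissible_def by (intro conjI ballI exI[of _ "{\<one>}"]) auto
qed

lemma translate_refine:
  assumes "\<T> \<subseteq> patterns" and "\<And>t g. t \<in> \<T> \<Longrightarrow> g \<in> carrier G \<Longrightarrow> translate t g \<in> \<T>"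
    and "C \<subseteq> carrier G" "E \<subseteq> carrier G" "t \<in> \<T>" "s \<in> refine \<T> C t E r" "g \<in> carrier G"
  shows "translate s g \<in> refine \<T> C t E r"
proof -
  have s: "s \<in> \<T>" using assms by (simp add: refine_def)
  have st: "supp s \<subseteq> carrier G" "supp t \<subseteq> carrier G" using s assms(1,5) by (auto intro!: pattern_props(3))
  have "(\<exists>e\<in>E. translate t (e \<otimes> d) \<subseteq> translate s g) \<or>
      r \<le> card {e \<in> E. (C #> (e \<otimes> d)) \<inter> supp (translate s g) = {}}" if d: "d \<in> carrier G" for d
  proof -
    let ?d = "d \<otimes> inv g"
    have ed: "e \<otimes> ?d \<otimes> g = e \<otimes> d" if "e \<in> E" for e
      using that assms d by (simp add: m_assoc subset_iff)
    have dc: "?d \<in> carrier G" using d assms by simp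
    have "(\<exists>e\<in>E. translate t (e \<otimes> ?d) \<subseteq> s) \<or> r \<le> card {e \<in> E. (C #> (e \<otimes> ?d)) \<inter> supp s = {}}"
      using assms(6) dc by (simp add: refine_def)
    then show ?thesis
    proof (elim disjE bexE)
      fix e assume e: "e \<in> E" "translate t (e \<otimes> ?d) \<subseteq> s"
      have "translate t (e \<otimes> d) = translate (translate t (e \<otimes> ?d)) g"
        using translate_translate[OF st(2), of "e \<otimes> ?d" g] ed[OF e(1)] e(1) assms(4,7) dc
        by (metis m_closed subsetD)
      then show ?thesis using e translate_mono by metis
    next
      assume r: "r \<le> card {e \<in> E. (C #> (e \<otimes> ?d)) \<inter> supp s = {}}"
      have "(C #> (e \<otimes> ?d)) \<inter> supp s = {} \<longleftrightarrow> (C #> (e \<otimes> d)) \<inter> supp (translate s g) = {}"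
        if e: "e \<in> E" for e
      proof -
        have ec: "e \<in> carrier G" using e assms by auto
        have eqv: "c \<otimes> (e \<otimes> ?d) \<in> supp s \<longleftrightarrow> c \<otimes> (e \<otimes> d) \<in> supp s #> g" if c: "c \<in> C" for c
        proof -
          have cc: "c \<in> carrier G" using c assms by auto
          have eq: "c \<otimes> (e \<otimes> d) = c \<otimes> (e \<otimes> ?d) \<otimes> g"
            using ed[OF e] cc ec dc assms by (simp add: m_assoc)
          show ?thesis
            unfolding eq mem_r_coset using st(1) cc ec dc assms
            by (auto simp: subset_iff)
        qed
        have disj: "(C #> p) \<inter> A = {} \<longleftrightarrow> (\<forall>c\<in>C. c \<otimes> p \<notin> A)" for p A
          unfolding r_coset_def by blast
        show ?thesis
          unfolding supp_translate disj
          by (intro ball_cong refl arg_cong[where f = Not]) (rule eqv)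
      qed
      then have "{e \<in> E. (C #> (e \<otimes> ?d)) \<inter> supp s = {}}
          = {e \<in> E. (C #> (e \<otimes> d)) \<inter> supp (translate s g) = {}}" by blast
      then show ?thesis using r by simp
    qed
  qed
  then show ?thesis using assms(2) s assms(7) unfolding refine_def by blast
qed

section \<open>Refining an admissible family\<close>

lemma hits_many_classes:
  assumes "finite X" "\<And>j. j < (r::nat) \<Longrightarrow> \<exists>e\<in>X. cls e = j"
  shows "r \<le> card X"
proof -
  have "{..<r} \<subseteq> cls ` X" using assms(2) by force
  then have "card {..<r} \<le> card (cls ` X)" using assms(1) by (intro card_mono) auto
  also have "\<dots> \<le> card X" by (rule card_image_le[OF assms(1)])
  finally show ?thesis by simp
qed

lemma inv_mult_cancel:
  assumes "x \<in> carrier G" "y \<in> carrier G"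
  shows "inv x \<otimes> (x \<otimes> y) = y"
  using assms by (simp add: m_assoc[symmetric])

text \<open>
  The copy of \<open>t\<close> at place \<open>p\<close> has a \<open>K\<close>-neighbourhood disjoint from that of a pattern \<open>s\<close> whenever the
  translate of the footprint by \<open>p\<close> misses the support of \<open>s\<close>.
\<close>
definition footprint :: "'a set \<Rightarrow> ('a \<times> bool) set \<Rightarrow> 'a set" where
  "footprint K t = insert \<one> {inv k \<otimes> (k' \<otimes> v) | k k' v. k \<in> K \<and> k' \<in> K \<and> v \<in> supp t}"

lemma footprint:
  assumes "finite K" "K \<subseteq> carrier G" "finite (supp t)" "supp t \<subseteq> carrier G"
  shows "finite (footprint K t)" "footprint K t \<subseteq> carrier G" "\<one> \<in> footprint K t"
proof -
  have "footprint K t = insert \<one> ((\<lambda>(k, k', v). inv k \<otimes> (k' \<otimes> v)) ` (K \<times> K \<times> supp t))"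
    unfolding footprint_def by force
  then show "finite (footprint K t)" using assms by simp
  show "footprint K t \<subseteq> carrier G" unfolding footprint_def using assms by (auto simp: subset_iff)
  show "\<one> \<in> footprint K t" by (simp add: footprint_def)
qed

text \<open>
  Given patterns \<open>F\<close> of the refined family, call \<open>d\<close> touched by \<open>s \<in> F\<close> if some place \<open>e d\<close> is not free with respect
  to \<open>s\<close>. The constant \<open>K'\<close> is so large that \<open>d\<close> is touched by at most one \<open>s\<close> and that all places \<open>e d\<close> then
  lie in the block of \<open>s\<close>. If \<open>s\<close> has no copy of \<open>t\<close> for \<open>d\<close>, at least \<open>r\<close> places are free, and a copy is
  planted at one of them. For an untouched \<open>d\<close> all \<open>r\<^sup>2\<close> places are free, and copies are planted in each of
  \<open>r\<close> classes of \<open>r\<close> places. All this is planted by means of \<open>\<T>\<close>, with the given blocks enlarged by the copies that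
  come near them, and with the remaining copies as blocks of their own.

  The restriction of the resulting point to a set \<open>V\<close> that respects these blocks is in the refined family. If
  \<open>d\<close> is touched, the block of \<open>s\<close> is contained in \<open>V\<close>, together with a copy of \<open>t\<close>, or it is disjoint from
  \<open>V\<close> and all places are open. If \<open>d\<close> is untouched and \<open>V\<close> contains none of the \<open>r\<close> copies for \<open>d\<close>, it misses the
  blocks of all of them, and their \<open>r\<close> places are open.
\<close>
lemma plantable_refine:
  assumes \<T>: "\<T> \<subseteq> patterns" and inv\<T>: "\<And>t g. t \<in> \<T> \<Longrightarrow> g \<in> carrier G \<Longrightarrow> translate t g \<in> \<T>"
    and K: "finite K" "K \<subseteq> carrier G" "\<one> \<in> K" and plant: "plantable \<T> K"
    and t: "t \<in> \<T>"
    and C: "C = footprint K t"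
    and L: "L = {inv p \<otimes> q | p q. p \<in> K <#> C \<and> q \<in> K <#> C}"
    and E: "E \<subseteq> carrier G" "finite E" "card E = r * r" and r: "card C < r"
    and hit: "\<And>fam. \<forall>d\<in>carrier G. finite (fam d) \<and> card (fam d) \<le> r \<and>
                (\<forall>H\<in>fam d. H \<subseteq> E #> d \<and> r \<le> card H + card C) \<Longrightarrow>
              \<exists>\<Delta>. \<Delta> \<subseteq> (\<Union>d\<in>carrier G. \<Union>(fam d)) \<and>
                (\<forall>d\<in>carrier G. \<forall>H\<in>fam d. H \<inter> \<Delta> \<noteq> {}) \<and>
                (\<forall>p\<in>\<Delta>. \<forall>p'\<in>\<Delta>. p' \<in> L #> p \<longrightarrow> p' = p)"
    and K': "K' = K \<union> {p \<otimes> inv q | p q. p \<in> C <#> E \<and> q \<in> C <#> E}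
                 \<union> {inv p \<otimes> k | p k. p \<in> K <#> C \<and> k \<in> K}"
  shows "plantable (refine \<T> C t E r) K'"
proof -
  have suppt: "finite (supp t)" "supp t \<subseteq> carrier G"
    using pattern_props(2,3)[of t] t \<T> by blast+
  have Cc: "finite C" "C \<subseteq> carrier G" "\<one> \<in> C"
    unfolding C using footprint[OF K(1,2) suppt] by blast+
  have tC: "k \<otimes> v \<in> C" if "k \<in> K" "v \<in> supp t" for k v
  proof -
    have "k \<otimes> v = inv \<one> \<otimes> (k \<otimes> v)" using that K suppt by (simp add: subset_iff)
    then show ?thesis unfolding C footprint_def using that K(3) by blast
  qed
  have KtC: "K <#> supp (translate t p) \<subseteq> C #> p" if p: "p \<in> carrier G" for p
  proof
    fix z assume "z \<in> K <#> supp (translate t p)"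
    then obtain k v where kv: "k \<in> K" "v \<in> supp t" "z = k \<otimes> (v \<otimes> p)"
      unfolding supp_translate set_mult_def r_coset_def by blast
    then have "z = (k \<otimes> v) \<otimes> p" using K suppt p by (simp add: m_assoc subset_iff)
    then show "z \<in> C #> p" using tC kv unfolding mem_r_coset by blast
  qed
  have suppC: "supp (translate t p) \<subseteq> C #> p" if p: "p \<in> carrier G" for p
  proof
    fix z assume z: "z \<in> supp (translate t p)"
    then have "z \<in> carrier G" using suppt p unfolding supp_translate mem_r_coset by auto
    then have "z = \<one> \<otimes> z" by simp
    then have "z \<in> K <#> supp (translate t p)" using z K(3) unfolding mem_set_mult by blast
    then show "z \<in> C #> p" using KtC[OF p] by blast
  qed
  have KK': "K <#> A \<subseteq> K' <#> A" for A unfolding K' set_mult_def by blast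
  show ?thesis
    unfolding plantable_def
  proof (intro allI impI, elim conjE)
    fix F B w g
    assume F: "F \<subseteq> refine \<T> C t E r" and dF: "disjoint_family_on (\<lambda>s. K' <#> supp s) F"
      and B: "\<forall>b\<in>B. finite b \<and> b \<subseteq> carrier G" and dB: "disjoint_family_on (\<lambda>b. K' <#> b) B"
      and FB: "\<forall>s\<in>F. \<exists>b\<in>B. K' <#> supp s \<subseteq> b"
      and w: "w \<in> carrier G" "\<forall>s\<in>F. w \<notin> supp s" and g: "g \<in> carrier G" "g \<noteq> \<one>"
    have F\<T>: "F \<subseteq> \<T>" using F by (auto simp: refine_def)
    have suppF: "finite (supp s)" "supp s \<subseteq> carrier G" if "s \<in> F" for s
      using pattern_props(2,3)[of s] that F\<T> \<T> by blast+
    define free where "free p s \<longleftrightarrow> (C #> p) \<inter> supp s = {}" for p and s :: "('a \<times> bool) set"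
    define touch where "touch d s \<longleftrightarrow> s \<in> F \<and> (\<exists>e\<in>E. \<not> free (e \<otimes> d) s)" for d s
    define sat where "sat d s \<longleftrightarrow> (\<exists>e\<in>E. translate t (e \<otimes> d) \<subseteq> s)" for d and s :: "('a \<times> bool) set"
    have touch_near: "C #> (e \<otimes> d) \<subseteq> K' <#> supp s"
      if d: "d \<in> carrier G" and "touch d s" and e: "e \<in> E" for d s e
    proof
      fix z assume "z \<in> C #> (e \<otimes> d)"
      then obtain c where c: "c \<in> C" "z = c \<otimes> (e \<otimes> d)" unfolding mem_r_coset by blast
      obtain c' e' where c': "e' \<in> E" "c' \<in> C" "c' \<otimes> (e' \<otimes> d) \<in> supp s"
        using \<open>touch d s\<close> unfolding touch_def free_def r_coset_def by blast
      let ?p = "c \<otimes> e" and ?q = "c' \<otimes> e'"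
      have car: "c \<in> carrier G" "c' \<in> carrier G" "e \<in> carrier G" "e' \<in> carrier G"
        using c c' e E Cc by auto
      then have "z = (?p \<otimes> inv ?q) \<otimes> (c' \<otimes> (e' \<otimes> d))"
        using c d by (simp add: m_assoc[symmetric]) (simp add: m_assoc)
      moreover have "?p \<otimes> inv ?q \<in> K'"
        unfolding K' using c c' e mem_set_mult by blast
      ultimately show "z \<in> K' <#> supp s" using c'(3) unfolding mem_set_mult by blast
    qed
    have touch_unique: "s = s'" if d: "d \<in> carrier G" and "touch d s" "touch d s'" for d s s'
    proof (rule ccontr)
      assume "s \<noteq> s'"
      obtain e where e: "e \<in> E" using \<open>touch d s\<close> by (auto simp: touch_def)
      have "e \<otimes> d \<in> C #> (e \<otimes> d)"
        using Cc(3) e E d unfolding mem_r_coset by (intro bexI[of _ "\<one>"]) auto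
      then have "e \<otimes> d \<in> (K' <#> supp s) \<inter> (K' <#> supp s')"
        using touch_near[OF d _ e] that by blast
      then show False using dF \<open>s \<noteq> s'\<close> that unfolding disjoint_family_on_def touch_def by blast
    qed
    \<comment> \<open>Keeping the hole \<open>w\<close> free forbids at most \<open>card C\<close> places for every \<open>d\<close>; this is the slack
      in the hitting sets.\<close>
    have card_hole: "card {e \<in> E. w \<in> C #> (e \<otimes> d)} \<le> card C" if d: "d \<in> carrier G" for d
    proof -
      have "{e \<in> E. w \<in> C #> (e \<otimes> d)} \<subseteq> (\<lambda>c. inv c \<otimes> (w \<otimes> inv d)) ` C"
      proof
        fix e assume "e \<in> {e \<in> E. w \<in> C #> (e \<otimes> d)}"
        then obtain c where c: "e \<in> E" "c \<in> C" "w = c \<otimes> (e \<otimes> d)" unfolding mem_r_coset by blast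
        have "c \<in> carrier G" "e \<in> carrier G" using c E Cc by auto
        then have "e = inv c \<otimes> (w \<otimes> inv d)"
          using c d by (simp add: m_assoc) (simp add: m_assoc[symmetric])
        then show "e \<in> (\<lambda>c. inv c \<otimes> (w \<otimes> inv d)) ` C" using c by blast
      qed
      then show ?thesis using Cc(1) by (meson surj_card_le)
    qed
    define avail where "avail X d = (\<lambda>e. e \<otimes> d) ` {e \<in> X. w \<notin> C #> (e \<otimes> d)}" for X d
    have card_avail: "r \<le> card (avail X d) + card C"
      if "X \<subseteq> E" "r \<le> card X" "d \<in> carrier G" for X d
    proof -
      have finX: "finite X" using that E finite_subset by blast
      have "inj_on (\<lambda>e. e \<otimes> d) {e \<in> X. w \<notin> C #> (e \<otimes> d)}"
        using that E by (intro inj_onI) (auto simp: subset_iff)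
      then have "card (avail X d) = card {e \<in> X. w \<notin> C #> (e \<otimes> d)}"
        unfolding avail_def by (rule card_image)
      moreover have "card X = card {e \<in> X. w \<notin> C #> (e \<otimes> d)} + card {e \<in> X. w \<in> C #> (e \<otimes> d)}"
        using finX by (subst card_Un_disjoint[symmetric]) (auto intro!: arg_cong[where f = card])
      moreover have "card {e \<in> X. w \<in> C #> (e \<otimes> d)} \<le> card {e \<in> E. w \<in> C #> (e \<otimes> d)}"
        using E that by (intro card_mono) auto
      ultimately show ?thesis using that card_hole[of d] by linarith
    qed
    obtain \<phi> :: "nat \<times> nat \<Rightarrow> 'a" where \<phi>: "bij_betw \<phi> ({..<r} \<times> {..<r}) E"
    proof -
      have "card ({..<r} \<times> {..<r}) = card E" using E by (simp add: card_cartesian_product)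
      then show ?thesis using that E(2) by (metis finite_SigmaI finite_lessThan finite_same_card_bij)
    qed
    define blk where "blk j = \<phi> ` ({j} \<times> {..<r})" for j
    define cls where "cls e = fst (inv_into ({..<r} \<times> {..<r}) \<phi> e)" for e
    have blk: "blk j \<subseteq> E" "card (blk j) = r" "\<And>e. e \<in> blk j \<Longrightarrow> cls e = j" if "j < r" for j
    proof -
      have sub: "{j} \<times> {..<r} \<subseteq> {..<r} \<times> {..<r}" using that by auto
      show "blk j \<subseteq> E" using \<phi> sub unfolding blk_def bij_betw_def by blast
      have "card (blk j) = card ({j} \<times> {..<r})"
        unfolding blk_def using \<phi> sub by (intro card_image) (auto simp: bij_betw_def inj_on_def)
      then show "card (blk j) = r" by (simp add: card_cartesian_product)
      show "cls e = j" if "e \<in> blk j" for e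
        using that \<phi> \<open>j < r\<close> unfolding blk_def cls_def bij_betw_def by (auto simp: inv_into_f_f)
    qed
    define fam where "fam d = (if \<exists>s. touch d s
        then (if \<exists>s. touch d s \<and> sat d s then {} else {avail {e \<in> E. \<forall>s\<in>F. free (e \<otimes> d) s} d})
        else (\<lambda>j. avail (blk j) d) ` {..<r})" for d
    have fam_cases:
      "\<exists>s. touch d s \<and> sat d s \<Longrightarrow> fam d = {}"
      "\<exists>s. touch d s \<Longrightarrow> \<not> (\<exists>s. touch d s \<and> sat d s) \<Longrightarrow>
        fam d = {avail {e \<in> E. \<forall>s\<in>F. free (e \<otimes> d) s} d}"
      "\<not> (\<exists>s. touch d s) \<Longrightarrow> fam d = (\<lambda>j. avail (blk j) d) ` {..<r}" for d
      unfolding fam_def by (simp_all only: if_True if_False, metis)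
    have fam: "finite (fam d) \<and> card (fam d) \<le> r \<and>
        (\<forall>H\<in>fam d. H \<subseteq> E #> d \<and> r \<le> card H + card C)" if d: "d \<in> carrier G" for d
    proof -
      have sub: "avail X d \<subseteq> E #> d" if "X \<subseteq> E" for X
        using that by (auto simp: avail_def r_coset_def)
      consider s where "touch d s" "\<not> sat d s" "fam d = {avail {e \<in> E. \<forall>s\<in>F. free (e \<otimes> d) s} d}"
        | "fam d = {}" | "fam d = (\<lambda>j. avail (blk j) d) ` {..<r}"
        using fam_cases[of d] by blast
      then show ?thesis
      proof cases
        case 1
        have "{e \<in> E. \<forall>s\<in>F. free (e \<otimes> d) s} = {e \<in> E. free (e \<otimes> d) s}"
          using touch_unique[OF d 1(1)] 1(1) unfolding touch_def by blast
        moreover have "s \<in> refine \<T> C t E r" using 1(1) F by (auto simp: touch_def)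
        then have "r \<le> card {e \<in> E. free (e \<otimes> d) s}"
          using 1(2) d unfolding refine_def sat_def free_def by blast
        ultimately show ?thesis
          unfolding 1(3) using sub card_avail[OF _ _ d, of "{e \<in> E. \<forall>s\<in>F. free (e \<otimes> d) s}"] r by auto
      next
        case 3
        have "card ((\<lambda>j. avail (blk j) d) ` {..<r}) \<le> r"
          using card_image_le[of "{..<r}" "\<lambda>j. avail (blk j) d"] by simp
        then show ?thesis
          unfolding 3 using blk sub card_avail[OF _ _ d] by auto
      qed simp
    qed
    have "\<exists>\<Delta>. \<Delta> \<subseteq> (\<Union>d\<in>carrier G. \<Union>(fam d)) \<and>
        (\<forall>d\<in>carrier G. \<forall>H\<in>fam d. H \<inter> \<Delta> \<noteq> {}) \<and>
        (\<forall>p\<in>\<Delta>. \<forall>p'\<in>\<Delta>. p' \<in> L #> p \<longrightarrow> p' = p)"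
      by (rule hit, rule ballI, rule fam)
    then obtain \<Delta> where \<Delta>_all: "\<Delta> \<subseteq> (\<Union>d\<in>carrier G. \<Union>(fam d)) \<and>
        (\<forall>d\<in>carrier G. \<forall>H\<in>fam d. H \<inter> \<Delta> \<noteq> {}) \<and>
        (\<forall>p\<in>\<Delta>. \<forall>p'\<in>\<Delta>. p' \<in> L #> p \<longrightarrow> p' = p)" ..
    note \<Delta> = \<Delta>_all[THEN conjunct1]
      \<Delta>_all[THEN conjunct2, THEN conjunct1, rule_format]
      \<Delta>_all[THEN conjunct2, THEN conjunct2, rule_format]
    have \<Delta>car: "p \<in> carrier G" if "p \<in> \<Delta>" for p
      using that \<Delta>(1) fam r_coset_subset_G[OF E(1)] by blast
    have \<Delta>ok: "(\<forall>s\<in>F. free p s) \<and> w \<notin> C #> p" if p: "p \<in> \<Delta>" for p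
    proof -
      obtain d H where d: "d \<in> carrier G" "H \<in> fam d" "p \<in> H" using p \<Delta>(1) by blast
      show ?thesis
      proof (cases "\<exists>s. touch d s")
        case True
        moreover have "\<not> (\<exists>s. touch d s \<and> sat d s)" using fam_cases(1)[of d] d(2) by auto
        ultimately have "H = avail {e \<in> E. \<forall>s\<in>F. free (e \<otimes> d) s} d"
          using fam_cases(2)[of d] d(2) by simp
        then obtain e where "p = e \<otimes> d" "\<forall>s\<in>F. free (e \<otimes> d) s" "w \<notin> C #> (e \<otimes> d)"
          using d(3) unfolding avail_def by blast
        then show ?thesis by simp
      next
        case False
        then obtain j where j: "j < r" "p \<in> avail (blk j) d"
          using d(2,3) fam_cases(3)[of d] by auto
        then obtain e where e: "e \<in> E" "p = e \<otimes> d" "w \<notin> C #> p"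
          using blk(1) unfolding avail_def by blast
        then show ?thesis using False unfolding touch_def by blast
      qed
    qed
    define bl where "bl p = C #> p" for p
    have bl: "finite (bl p)" "bl p \<subseteq> carrier G" if "p \<in> \<Delta>" for p
      using Cc \<Delta>car[OF that] by (auto simp: bl_def r_coset_def)
    have sepD: "(K <#> bl p) \<inter> (K <#> bl p') = {}" if p: "p \<in> \<Delta>" "p' \<in> \<Delta>" "p \<noteq> p'" for p p'
    proof (rule ccontr)
      assume "(K <#> bl p) \<inter> (K <#> bl p') \<noteq> {}"
      then obtain k c k' c' where kc: "k \<in> K" "c \<in> C" "k' \<in> K" "c' \<in> C"
          "k \<otimes> (c \<otimes> p) = k' \<otimes> (c' \<otimes> p')"
        unfolding bl_def set_mult_def r_coset_def by blast
      have car: "k \<in> carrier G" "c \<in> carrier G" "k' \<in> carrier G" "c' \<in> carrier G"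
          "p \<in> carrier G" "p' \<in> carrier G"
        using kc K Cc p \<Delta>car by auto
      have "p' = inv (k' \<otimes> c') \<otimes> ((k' \<otimes> c') \<otimes> p')"
        using car inv_mult_cancel[of "k' \<otimes> c'" p'] by simp
      also have "(k' \<otimes> c') \<otimes> p' = (k \<otimes> c) \<otimes> p"
        using car kc(5) by (simp add: m_assoc)
      also have "inv (k' \<otimes> c') \<otimes> ((k \<otimes> c) \<otimes> p) = (inv (k' \<otimes> c') \<otimes> (k \<otimes> c)) \<otimes> p"
        using car by (simp add: m_assoc)
      finally have "p' = (inv (k' \<otimes> c') \<otimes> (k \<otimes> c)) \<otimes> p" .
      moreover have "inv (k' \<otimes> c') \<otimes> (k \<otimes> c) \<in> L"
        unfolding L using kc mem_set_mult by blast
      ultimately have "p' \<in> L #> p" unfolding mem_r_coset by blast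
      then show False using \<Delta>(3) p by blast
    qed
    define touching where "touching p b \<longleftrightarrow> (K <#> bl p) \<inter> (K <#> b) \<noteq> {}" for p b
    have touching_near: "p \<in> K' <#> b" if p: "p \<in> \<Delta>" and b: "b \<subseteq> carrier G" and "touching p b" for p b
    proof -
      obtain k c k' a where kc: "k \<in> K" "c \<in> C" "k' \<in> K" "a \<in> b"
          "k \<otimes> (c \<otimes> p) = k' \<otimes> a"
        using \<open>touching p b\<close> unfolding touching_def bl_def set_mult_def r_coset_def by blast
      have car: "k \<in> carrier G" "c \<in> carrier G" "k' \<in> carrier G" "a \<in> carrier G" "p \<in> carrier G"
        using kc K Cc p \<Delta>car b by auto
      have "p = inv (k \<otimes> c) \<otimes> ((k \<otimes> c) \<otimes> p)"
        using car inv_mult_cancel[of "k \<otimes> c" p] by simp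
      also have "(k \<otimes> c) \<otimes> p = k' \<otimes> a"
        using car kc(5) by (simp add: m_assoc)
      also have "inv (k \<otimes> c) \<otimes> (k' \<otimes> a) = (inv (k \<otimes> c) \<otimes> k') \<otimes> a"
        using car by (simp add: m_assoc)
      finally have "p = (inv (k \<otimes> c) \<otimes> k') \<otimes> a" .
      moreover have "inv (k \<otimes> c) \<otimes> k' \<in> K'"
        unfolding K' using kc mem_set_mult by blast
      ultimately show ?thesis using kc(4) unfolding mem_set_mult by blast
    qed
    have touching_unique: "b = b'"
      if "p \<in> \<Delta>" "b \<in> B" "b' \<in> B" "touching p b" "touching p b'" for p b b'
      using touching_near[of p b] touching_near[of p b'] that B dB
      unfolding disjoint_family_on_def by blast
    \<comment> \<open>Blocks of the given system are enlarged by the copies near them. By \<open>touching_unique\<close> no copy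
      links two blocks, so the enlarged blocks stay finite and apart.\<close>
    define ext where "ext b = b \<union> \<Union>(bl ` {p \<in> \<Delta>. touching p b})" for b
    define B2 where "B2 = ext ` B \<union> bl ` {p \<in> \<Delta>. \<forall>b\<in>B. \<not> touching p b}"
    define F2 where "F2 = F \<union> translate t ` \<Delta>"
    have F2: "F2 \<subseteq> \<T>" using F\<T> inv\<T>[OF t] \<Delta>car by (auto simp: F2_def)
    have sF\<Delta>: "(K <#> supp s) \<inter> (K <#> supp (translate t p)) = {}" if "s \<in> F" "p \<in> \<Delta>" for s p
    proof (rule ccontr)
      assume "(K <#> supp s) \<inter> (K <#> supp (translate t p)) \<noteq> {}"
      then obtain k a k' v where kv: "k \<in> K" "a \<in> supp s" "k' \<in> K" "v \<in> supp t"
          "k \<otimes> a = k' \<otimes> (v \<otimes> p)"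
        unfolding supp_translate set_mult_def r_coset_def by blast
      have car: "k \<in> carrier G" "a \<in> carrier G" "k' \<in> carrier G" "v \<in> carrier G" "p \<in> carrier G"
        using kv K suppt that \<Delta>car suppF[of s] by auto
      have "a = inv k \<otimes> (k \<otimes> a)" using car inv_mult_cancel by simp
      also have "\<dots> = (inv k \<otimes> (k' \<otimes> v)) \<otimes> p" using car kv(5) by (simp add: m_assoc)
      finally have "a = (inv k \<otimes> (k' \<otimes> v)) \<otimes> p" .
      moreover have "inv k \<otimes> (k' \<otimes> v) \<in> C" unfolding C footprint_def using kv by blast
      ultimately have "a \<in> C #> p" unfolding mem_r_coset by blast
      then show False using \<Delta>ok[OF that(2)] that(1) kv(2) unfolding free_def by blast
    qed
    have dF2: "disjoint_family_on (\<lambda>s. K <#> supp s) F2"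
    proof -
      have FF: "(K <#> supp s) \<inter> (K <#> supp s') = {}" if "s \<in> F" "s' \<in> F" "s \<noteq> s'" for s s'
        using dF that KK' unfolding disjoint_family_on_def by blast
      have DD: "(K <#> supp (translate t p)) \<inter> (K <#> supp (translate t p')) = {}"
        if "p \<in> \<Delta>" "p' \<in> \<Delta>" "translate t p \<noteq> translate t p'" for p p'
      proof -
        have "K <#> supp (translate t q) \<subseteq> K <#> bl q" if "q \<in> \<Delta>" for q
          using suppC[OF \<Delta>car[OF that]] unfolding bl_def set_mult_def by blast
        moreover have "p \<noteq> p'" using that by blast
        ultimately show ?thesis using sepD[of p p'] that by blast
      qed
      show ?thesis
        unfolding disjoint_family_on_def F2_def
      proof (intro ballI impI)
        fix u v assume uv: "u \<in> F \<union> translate t ` \<Delta>" "v \<in> F \<union> translate t ` \<Delta>" "u \<noteq> v"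
        then show "(K <#> supp u) \<inter> (K <#> supp v) = {}"
          using FF DD sF\<Delta> by (elim UnE imageE) (simp_all, blast+)
      qed
    qed
    have B2: "\<forall>b\<in>B2. finite b \<and> b \<subseteq> carrier G"
    proof -
      have "finite (ext b) \<and> ext b \<subseteq> carrier G" if b: "b \<in> B" for b
      proof -
        have "{p \<in> \<Delta>. touching p b} \<subseteq> K' <#> b"
          using touching_near B b by blast
        moreover have "finite (K' <#> b)"
        proof -
          have "finite (C <#> E)" "finite (K <#> C)"
            using Cc E K by (auto simp: set_mult_def)
          then have "finite {p \<otimes> inv q | p q. p \<in> C <#> E \<and> q \<in> C <#> E}"
            "finite {inv p \<otimes> k | p k. p \<in> K <#> C \<and> k \<in> K}"
            using K by (auto intro!: finite_image_set2)
          then have "finite K'" using K by (simp add: K')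
          then show ?thesis using B b by (auto simp: set_mult_def)
        qed
        ultimately have "finite {p \<in> \<Delta>. touching p b}" by (rule finite_subset)
        then show ?thesis using B b bl by (auto simp: ext_def)
      qed
      then show ?thesis using bl unfolding B2_def by (elim UnE imageE | intro ballI | simp)+
    qed
    have K_ext: "v \<in> K <#> b \<or> (\<exists>p\<in>\<Delta>. touching p b \<and> v \<in> K <#> bl p)" if "v \<in> K <#> ext b" for v b
      using that unfolding ext_def set_mult_def by blast
    have dB2: "disjoint_family_on (\<lambda>b. K <#> b) B2"
    proof -
      have BB: "(K <#> ext b) \<inter> (K <#> ext b') = {}" if b: "b \<in> B" "b' \<in> B" "b \<noteq> b'" for b b'
      proof (rule ccontr)
        assume "(K <#> ext b) \<inter> (K <#> ext b') \<noteq> {}"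
        then obtain v where v: "v \<in> K <#> ext b" "v \<in> K <#> ext b'" by blast
        have 1: "(K <#> b) \<inter> (K <#> b') = {}"
          using dB b KK' unfolding disjoint_family_on_def by blast
        have 2: "v \<notin> K <#> bl p" if "p \<in> \<Delta>" "touching p c" "v \<in> K <#> c'" "c \<in> B" "c' \<in> B" "c \<noteq> c'"
          for p c c'
          using touching_unique[of p c c'] that unfolding touching_def by blast
        have 3: "p = p'" if "p \<in> \<Delta>" "p' \<in> \<Delta>" "v \<in> K <#> bl p" "v \<in> K <#> bl p'" for p p'
          using sepD[of p p'] that by blast
        show False
          using K_ext[OF v(1)] K_ext[OF v(2)] 1 2 3 touching_unique b by (elim disjE bexE conjE) blast+
      qed
      have BD: "(K <#> ext b) \<inter> (K <#> bl p) = {}"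
        if b: "b \<in> B" and p: "p \<in> \<Delta>" "\<not> touching p b" for b p
      proof (rule ccontr)
        assume "(K <#> ext b) \<inter> (K <#> bl p) \<noteq> {}"
        then obtain v where v: "v \<in> K <#> ext b" "v \<in> K <#> bl p" by blast
        from K_ext[OF v(1)] show False
        proof
          assume "v \<in> K <#> b"
          then show False using v p unfolding touching_def by blast
        next
          assume "\<exists>p'\<in>\<Delta>. touching p' b \<and> v \<in> K <#> bl p'"
          then obtain p' where "p' \<in> \<Delta>" "touching p' b" "v \<in> K <#> bl p'" by blast
          then show False using sepD[of p p'] p v by blast
        qed
      qed
      show ?thesis
        unfolding disjoint_family_on_def
      proof (intro ballI impI)
        fix u v assume u: "u \<in> B2" and v: "v \<in> B2" and ne: "u \<noteq> v"
        from u consider b where "b \<in> B" "u = ext b"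
          | p where "p \<in> \<Delta>" "\<forall>b\<in>B. \<not> touching p b" "u = bl p"
          unfolding B2_def by blast
        then show "(K <#> u) \<inter> (K <#> v) = {}"
        proof cases
          case 1
          from v consider b' where "b' \<in> B" "v = ext b'"
            | p' where "p' \<in> \<Delta>" "\<forall>b\<in>B. \<not> touching p' b" "v = bl p'"
            unfolding B2_def by blast
          then show ?thesis using 1 BB BD ne by cases metis+
        next
          case 2
          from v consider b' where "b' \<in> B" "v = ext b'"
            | p' where "p' \<in> \<Delta>" "\<forall>b\<in>B. \<not> touching p' b" "v = bl p'"
            unfolding B2_def by blast
          then show ?thesis using 2 sepD BD ne by cases (metis Int_commute)+
        qed
      qed
    qed
    have extB2: "ext b \<in> B2" "b \<subseteq> ext b" if "b \<in> B" for b
      using that by (simp_all add: B2_def ext_def)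
    have bl_block: "\<exists>b\<in>B2. bl p \<subseteq> b" if p: "p \<in> \<Delta>" for p
    proof (cases "\<exists>b\<in>B. touching p b")
      case True
      then obtain b where b: "b \<in> B" "touching p b" by blast
      then have "bl p \<subseteq> ext b" using p by (auto simp: ext_def)
      then show ?thesis using extB2(1)[OF b(1)] by blast
    next
      case False
      then have "bl p \<in> B2" using p by (simp add: B2_def)
      then show ?thesis by blast
    qed
    have FB2: "\<forall>s\<in>F2. \<exists>b\<in>B2. K <#> supp s \<subseteq> b"
    proof
      fix u assume "u \<in> F2"
      then consider "u \<in> F" | p where "p \<in> \<Delta>" "u = translate t p" unfolding F2_def by blast
      then show "\<exists>b\<in>B2. K <#> supp u \<subseteq> b"
      proof cases
        case 1
        then obtain b where "b \<in> B" "K' <#> supp u \<subseteq> b" using FB by blast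
        then show ?thesis using KK'[of "supp u"] extB2[of b] by (meson subset_trans)
      next
        case 2
        then show ?thesis using bl_block[of p] KtC[OF \<Delta>car, of p] unfolding bl_def by (meson subset_trans)
      qed
    qed
    have "w \<notin> supp (translate t p)" if "p \<in> \<Delta>" for p
      using \<Delta>ok[OF that] suppC[OF \<Delta>car[OF that]] by (meson subsetD)
    then have w2: "\<forall>s\<in>F2. w \<notin> supp s"
      using w(2) unfolding F2_def by (elim UnE imageE | intro ballI | simp)+
    have "\<exists>x. (\<forall>s\<in>F2. extends x s) \<and> x (w \<otimes> g) \<noteq> x w \<and>
        (\<forall>W. finite W \<and> W \<subseteq> carrier G \<longrightarrow>
          (\<exists>V. finite V \<and> V \<subseteq> carrier G \<and> W \<subseteq> V \<and> graph_on x V \<in> \<T> \<and>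
             (\<forall>b\<in>B2. b \<inter> V \<noteq> {} \<longrightarrow> b \<subseteq> V)))"
      by (rule plant[unfolded plantable_def, rule_format])
        (intro conjI F2 dF2 B2 dB2 FB2 w(1) w2 g)
    then obtain x where x: "\<And>s. s \<in> F2 \<Longrightarrow> extends x s" "x (w \<otimes> g) \<noteq> x w"
      and ext_x: "\<And>W. finite W \<Longrightarrow> W \<subseteq> carrier G \<Longrightarrow>
          \<exists>V. finite V \<and> V \<subseteq> carrier G \<and> W \<subseteq> V \<and> graph_on x V \<in> \<T> \<and>
            (\<forall>b\<in>B2. b \<inter> V \<noteq> {} \<longrightarrow> b \<subseteq> V)"
      by metis
    have "\<exists>V. finite V \<and> V \<subseteq> carrier G \<and> W \<subseteq> V \<and> graph_on x V \<in> refine \<T> C t E r \<and>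
        (\<forall>b\<in>B. b \<inter> V \<noteq> {} \<longrightarrow> b \<subseteq> V)" if W: "finite W" "W \<subseteq> carrier G" for W
    proof -
      obtain V where V: "finite V" "V \<subseteq> carrier G" "W \<subseteq> V" "graph_on x V \<in> \<T>"
        and resp: "\<And>b. b \<in> B2 \<Longrightarrow> b \<inter> V \<noteq> {} \<Longrightarrow> b \<subseteq> V"
        using ext_x[OF W] by metis
      have respB: "b \<subseteq> V" if "b \<in> B" "b \<inter> V \<noteq> {}" for b
        using resp[OF extB2(1)[OF that(1)]] extB2(2)[OF that(1)] that(2) by blast
      have planted: "sat d (graph_on x V)"
        if "e \<in> E" "e \<otimes> d \<in> \<Delta>" "C #> (e \<otimes> d) \<subseteq> V" for e d
      proof -
        have "extends x (translate t (e \<otimes> d))"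
          using that(2) by (intro x(1)) (simp add: F2_def)
        then have "translate t (e \<otimes> d) \<subseteq> graph_on x V"
          using suppC[OF \<Delta>car[OF that(2)]] that(3) by (simp add: subset_graph_on)
        then show ?thesis using that(1) unfolding sat_def by blast
      qed
      have "sat d (graph_on x V) \<or> r \<le> card {e \<in> E. free (e \<otimes> d) (graph_on x V)}"
        if d: "d \<in> carrier G" for d
      proof (cases "\<exists>s. touch d s")
        case True
        then obtain s where s: "touch d s" "s \<in> F" unfolding touch_def by blast
        then obtain b where b: "b \<in> B" "K' <#> supp s \<subseteq> b" using FB by blast
        have near: "C #> (e \<otimes> d) \<subseteq> b" if "e \<in> E" for e
          using touch_near[OF d s(1) that] b(2) by blast
        show ?thesis
        proof (cases "b \<inter> V = {}")
          case True
          then have "{e \<in> E. free (e \<otimes> d) (graph_on x V)} = E"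
            using near unfolding free_def supp_graph_on by blast
          then show ?thesis using E r by simp
        next
          case False
          then have bV: "b \<subseteq> V" using respB b by blast
          show ?thesis
          proof (cases "sat d s")
            case True
            have "supp s \<subseteq> K' <#> supp s"
            proof
              fix v assume v: "v \<in> supp s"
              then have "v = \<one> \<otimes> v" using suppF[OF s(2)] by auto
              moreover have "\<one> \<in> K'" using K(3) by (simp add: K')
              ultimately show "v \<in> K' <#> supp s" using v unfolding mem_set_mult by blast
            qed
            then have "s \<subseteq> graph_on x V"
              using x(1)[of s] s(2) b(2) bV by (simp add: subset_graph_on F2_def)
            then show ?thesis using True unfolding sat_def by blast
          next
            case False
            have "fam d = {avail {e \<in> E. \<forall>s\<in>F. free (e \<otimes> d) s} d}"
              using False s(1) touch_unique[OF d s(1)] by (intro fam_cases(2)) blast+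
            then obtain e where "e \<in> E" "e \<otimes> d \<in> \<Delta>"
              using \<Delta>(2)[OF d] unfolding avail_def by blast
            then show ?thesis using planted near[of e] bV by (meson subset_trans)
          qed
        qed
      next
        case False
        have hits: "\<exists>e. e \<in> E \<and> cls e = j \<and> e \<otimes> d \<in> \<Delta>" if j: "j < r" for j
        proof -
          have "avail (blk j) d \<in> fam d" using fam_cases(3)[OF False] j by simp
          then obtain e where "e \<in> blk j" "e \<otimes> d \<in> \<Delta>"
            using \<Delta>(2)[OF d] unfolding avail_def by blast
          then show ?thesis using blk[OF j] by blast
        qed
        show ?thesis
        proof (cases "\<exists>e\<in>E. e \<otimes> d \<in> \<Delta> \<and> (C #> (e \<otimes> d)) \<inter> V \<noteq> {}")
          case True
          then obtain e where e: "e \<in> E" "e \<otimes> d \<in> \<Delta>" "bl (e \<otimes> d) \<inter> V \<noteq> {}"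
            unfolding bl_def by blast
          then obtain b where "b \<in> B2" "bl (e \<otimes> d) \<subseteq> b" using bl_block by blast
          then have "bl (e \<otimes> d) \<subseteq> V" using resp e(3) by blast
          then show ?thesis using planted e unfolding bl_def by blast
        next
          case no: False
          have "r \<le> card {e \<in> E. free (e \<otimes> d) (graph_on x V)}"
          proof (rule hits_many_classes)
            show "finite {e \<in> E. free (e \<otimes> d) (graph_on x V)}" using E by simp
            show "\<exists>e\<in>{e \<in> E. free (e \<otimes> d) (graph_on x V)}. cls e = j" if "j < r" for j
              using hits[OF that] no unfolding free_def supp_graph_on by blast
          qed
          then show ?thesis by blast
        qed
      qed
      then have "graph_on x V \<in> refine \<T> C t E r"
        using V(4) unfolding refine_def sat_def free_def by blast
      then show ?thesis using V respB by (intro exI[of _ V] conjI ballI impI)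
    qed
    then show "\<exists>x. (\<forall>s\<in>F. extends x s) \<and> x (w \<otimes> g) \<noteq> x w \<and>
        (\<forall>W. finite W \<and> W \<subseteq> carrier G \<longrightarrow>
          (\<exists>V. finite V \<and> V \<subseteq> carrier G \<and> W \<subseteq> V \<and> graph_on x V \<in> refine \<T> C t E r \<and>
             (\<forall>b\<in>B. b \<inter> V \<noteq> {} \<longrightarrow> b \<subseteq> V)))"
      using x unfolding F2_def by (intro exI[of _ x] conjI ballI allI impI) auto
  qed
qed

lemma admissible_extension:
  assumes "admissible \<T>" "t \<in> \<T>" "finite W" "W \<subseteq> carrier G"
    and "w \<in> carrier G" "w \<notin> supp t" "g \<in> carrier G" "g \<noteq> \<one>"
  obtains x V where "graph_on x V \<in> \<T>" "t \<subseteq> graph_on x V" "finite V" "V \<subseteq> carrier G" "W \<subseteq> V"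
    "x (w \<otimes> g) \<noteq> x w"
proof -
  obtain K where K: "finite K" "K \<subseteq> carrier G" "\<one> \<in> K" and plant: "plantable \<T> K"
    using assms(1) unfolding admissible_def by blast
  have t: "finite (supp t)" "supp t \<subseteq> carrier G"
    using pattern_props(2,3)[of t] assms(1,2) unfolding admissible_def by blast+
  have b: "finite (K <#> supp t)" "K <#> supp t \<subseteq> carrier G"
    using K t by (auto simp: set_mult_def)
  have "\<exists>x. (\<forall>s\<in>{t}. extends x s) \<and> x (w \<otimes> g) \<noteq> x w \<and>
        (\<forall>W. finite W \<and> W \<subseteq> carrier G \<longrightarrow>
          (\<exists>V. finite V \<and> V \<subseteq> carrier G \<and> W \<subseteq> V \<and> graph_on x V \<in> \<T> \<and>
             (\<forall>b\<in>{K <#> supp t}. b \<inter> V \<noteq> {} \<longrightarrow> b \<subseteq> V)))"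
    by (rule plant[unfolded plantable_def, rule_format])
      (use assms b in \<open>simp add: disjoint_family_on_def\<close>)
  then obtain x where x: "extends x t" "x (w \<otimes> g) \<noteq> x w"
    and ext: "\<And>W. finite W \<Longrightarrow> W \<subseteq> carrier G \<Longrightarrow>
        \<exists>V. finite V \<and> V \<subseteq> carrier G \<and> W \<subseteq> V \<and> graph_on x V \<in> \<T>"
    by (metis singletonI)
  obtain V where "finite V" "V \<subseteq> carrier G" "W \<union> supp t \<subseteq> V" "graph_on x V \<in> \<T>"
    using ext[of "W \<union> supp t"] assms t by auto
  then show ?thesis
    using that[of x V] x by (simp add: subset_graph_on)
qed

text \<open>
  The constants \<open>C\<close> and \<open>r\<close> depend on \<open>t\<close> and \<open>\<T>\<close> only. Once \<open>F\<close> is large, it contains a set \<open>E\<close> of \<open>r\<^sup>2\<close> elements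
  with disjoint \<open>L\<close>-neighbourhoods, to which \<open>hitting_set\<close> applies; any two copies at places of the hitting
  set then have disjoint \<open>K\<close>-neighbourhoods.
\<close>
lemma admissible_refine:
  assumes adm: "admissible \<T>" and t: "t \<in> \<T>"
  shows "\<exists>C n r. finite C \<and> C \<subseteq> carrier G \<and> \<one> \<in> C \<and> r > 0 \<and>
           (\<forall>F. F \<subseteq> carrier G \<and> finite F \<and> n \<le> card F \<longrightarrow>
             (\<exists>E\<subseteq>F. admissible (refine \<T> C t E r)))"
proof -
  obtain K where K: "finite K" "K \<subseteq> carrier G" "\<one> \<in> K" and plant: "plantable \<T> K"
    using adm unfolding admissible_def by blast
  have \<T>: "\<T> \<subseteq> patterns" and inv: "\<And>t g. t \<in> \<T> \<Longrightarrow> g \<in> carrier G \<Longrightarrow> translate t g \<in> \<T>"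
    using adm unfolding admissible_def by blast+
  have suppt: "finite (supp t)" "supp t \<subseteq> carrier G"
    using pattern_props(2,3)[of t] t \<T> by blast+
  define C where "C = footprint K t"
  have Cc: "finite C" "C \<subseteq> carrier G" "\<one> \<in> C"
    unfolding C_def using footprint[OF K(1,2) suppt] by blast+
  have quot: "finite {inv p \<otimes> q | p q. p \<in> A \<and> q \<in> A}" "{inv p \<otimes> q | p q. p \<in> A \<and> q \<in> A} \<subseteq> carrier G"
    if "finite A" "A \<subseteq> carrier G" for A
  proof -
    show "finite {inv p \<otimes> q | p q. p \<in> A \<and> q \<in> A}"
      using that by (auto intro!: finite_image_set2)
    show "{inv p \<otimes> q | p q. p \<in> A \<and> q \<in> A} \<subseteq> carrier G" using that by (auto simp: subset_iff)
  qed
  have KC: "finite (K <#> C)" "K <#> C \<subseteq> carrier G" "\<one> \<in> K <#> C"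
    using K Cc by (auto simp: set_mult_def intro!: bexI[of _ \<one>])
  define L where L: "L = {inv p \<otimes> q | p q. p \<in> K <#> C \<and> q \<in> K <#> C}"
  have one_quot: "\<one> \<in> {inv p \<otimes> q | p q. p \<in> A \<and> q \<in> A}" if "\<one> \<in> A" for A
  proof -
    have "\<one> = inv \<one> \<otimes> \<one>" by simp
    then show ?thesis using that by blast
  qed
  have Lc: "finite L" "L \<subseteq> carrier G" "\<one> \<in> L"
    unfolding L using quot[OF KC(1,2)] one_quot[OF KC(3)] by auto
  define M where M: "M = {inv p \<otimes> q | p q. p \<in> L \<and> q \<in> L}"
  have Mc: "finite M" "M \<subseteq> carrier G" "\<one> \<in> M"
    unfolding M using quot[OF Lc(1,2)] one_quot[OF Lc(3)] by auto
  have "\<exists>r>card C. \<forall>E fam. E \<subseteq> carrier G \<longrightarrow> finite E \<longrightarrow> card E = r * r \<longrightarrow>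
           disjoint_family_on (\<lambda>e. L #> e) E \<longrightarrow>
           (\<forall>d\<in>carrier G. finite (fam d) \<and> card (fam d) \<le> r \<and>
              (\<forall>H\<in>fam d. H \<subseteq> E #> d \<and> r \<le> card H + card C)) \<longrightarrow>
           (\<exists>\<Delta>. \<Delta> \<subseteq> (\<Union>d\<in>carrier G. \<Union>(fam d)) \<and>
              (\<forall>d\<in>carrier G. \<forall>H\<in>fam d. H \<inter> \<Delta> \<noteq> {}) \<and>
              (\<forall>p\<in>\<Delta>. \<forall>p'\<in>\<Delta>. p' \<in> L #> p \<longrightarrow> p' = p))"
    by (rule hitting_set[OF Lc])
  then obtain r where r: "card C < r" and hit: "\<forall>E fam. E \<subseteq> carrier G \<longrightarrow> finite E \<longrightarrow>
           card E = r * r \<longrightarrow> disjoint_family_on (\<lambda>e. L #> e) E \<longrightarrow>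
           (\<forall>d\<in>carrier G. finite (fam d) \<and> card (fam d) \<le> r \<and>
              (\<forall>H\<in>fam d. H \<subseteq> E #> d \<and> r \<le> card H + card C)) \<longrightarrow>
           (\<exists>\<Delta>. \<Delta> \<subseteq> (\<Union>d\<in>carrier G. \<Union>(fam d)) \<and>
              (\<forall>d\<in>carrier G. \<forall>H\<in>fam d. H \<inter> \<Delta> \<noteq> {}) \<and>
              (\<forall>p\<in>\<Delta>. \<forall>p'\<in>\<Delta>. p' \<in> L #> p \<longrightarrow> p' = p))"
    by (elim exE conjE)
  have "\<exists>E\<subseteq>F. admissible (refine \<T> C t E r)"
    if F: "F \<subseteq> carrier G" "finite F" "(r * r) * card M \<le> card F" for F
  proof -
    have "\<exists>E\<subseteq>F. card E = r * r \<and> (\<forall>x\<in>E. \<forall>y\<in>E. x \<noteq> y \<longrightarrow> y \<notin> M #> x)"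
    proof (rule separated_subset[of "card M"])
      show "0 < card M" using Mc by (auto simp: card_gt_0_iff)
      show "x \<in> M #> x \<and> finite (M #> x) \<and> card (M #> x) \<le> card M" if "x \<in> F" for x
      proof -
        have x: "x \<in> carrier G" using that F by blast
        then have "x \<in> M #> x" using Mc(3) unfolding mem_r_coset by (intro bexI[of _ \<one>]) auto
        then show ?thesis using card_translate[OF Mc(2) x] Mc(1) by (simp add: r_coset_def)
      qed
      show "x \<in> M #> y" if xy: "x \<in> F" "y \<in> F" "y \<in> M #> x" for x y
      proof -
        have c: "x \<in> carrier G" "y \<in> carrier G" using xy F by blast+
        obtain p q where pq: "p \<in> L" "q \<in> L" "y = (inv p \<otimes> q) \<otimes> x"
          using xy(3) unfolding mem_r_coset M by blast
        have "p \<in> carrier G" "q \<in> carrier G" using pq Lc by auto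
        then have "x = (inv q \<otimes> p) \<otimes> y"
          using pq(3) c by (simp add: m_assoc) (simp add: m_assoc[symmetric])
        then show ?thesis unfolding mem_r_coset M using pq by blast
      qed
    qed (use F in auto)
    then obtain E where E: "E \<subseteq> F" "card E = r * r" and
        sep: "\<And>x y. x \<in> E \<Longrightarrow> y \<in> E \<Longrightarrow> x \<noteq> y \<Longrightarrow> y \<notin> M #> x"
      by metis
    have Ec: "E \<subseteq> carrier G" "finite E" using E F finite_subset by auto
    have sparse: "disjoint_family_on (\<lambda>e. L #> e) E"
      unfolding disjoint_family_on_def
    proof (intro ballI impI, rule ccontr)
      fix e e' assume e: "e \<in> E" "e' \<in> E" "e \<noteq> e'" and "(L #> e) \<inter> (L #> e') \<noteq> {}"
      then obtain p q where pq: "p \<in> L" "q \<in> L" "p \<otimes> e = q \<otimes> e'"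
        unfolding r_coset_def by blast
      have c: "p \<in> carrier G" "q \<in> carrier G" "e \<in> carrier G" "e' \<in> carrier G"
        using pq Lc e Ec by auto
      then have "e' = inv q \<otimes> (p \<otimes> e)" using inv_mult_cancel[of q e'] pq(3) by simp
      then have "e' = (inv q \<otimes> p) \<otimes> e" using c by (simp add: m_assoc)
      then have "e' \<in> M #> e" unfolding mem_r_coset M using pq by blast
      then show False using sep e by blast
    qed
    define K' where K': "K' = K \<union> {p \<otimes> inv q | p q. p \<in> C <#> E \<and> q \<in> C <#> E}
                 \<union> {inv p \<otimes> k | p k. p \<in> K <#> C \<and> k \<in> K}"
    have CE: "finite (C <#> E)" "C <#> E \<subseteq> carrier G"
      using Cc Ec by (auto simp: set_mult_def)
    have "finite {p \<otimes> inv q | p q. p \<in> C <#> E \<and> q \<in> C <#> E}"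
      "finite {inv p \<otimes> k | p k. p \<in> K <#> C \<and> k \<in> K}"
      using CE KC K by (auto intro!: finite_image_set2)
    then have "finite K'" using K unfolding K' by blast
    moreover have "K' \<subseteq> carrier G" using K CE KC unfolding K' by (auto simp: subset_iff)
    moreover have "\<one> \<in> K'" using K by (simp add: K')
    moreover have "plantable (refine \<T> C t E r) K'"
      by (rule plantable_refine[OF \<T> inv K plant t C_def L Ec E(2) r
            hit[THEN spec, THEN spec, THEN mp, THEN mp, THEN mp, THEN mp, THEN mp,
              OF Ec E(2) sparse] K'])
    moreover have "refine \<T> C t E r \<subseteq> patterns" using \<T> by (auto simp: refine_def)
    moreover have "translate s g \<in> refine \<T> C t E r" if "s \<in> refine \<T> C t E r" "g \<in> carrier G" for s g
      by (rule translate_refine[OF \<T> inv Cc(2) Ec(1) t that])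
    ultimately have "admissible (refine \<T> C t E r)" unfolding admissible_def by blast
    then show ?thesis using E by blast
  qed
  moreover have "r > 0" using r by simp
  ultimately show ?thesis using Cc by blast
qed

section \<open>Conditions and generic points\<close>

text \<open>
  Everything that is reached from the full family by successive refinements with finite parameters. The levels
  show that this collection is countable.
\<close>
primrec refinement_level :: "nat \<Rightarrow> ('a \<times> bool) set set set" where
  "refinement_level 0 = {patterns}"
| "refinement_level (Suc n) = (\<lambda>(\<T>, C, t, E, r). refine \<T> C t E r) `
     (refinement_level n \<times> Fpow (carrier G) \<times> patterns \<times> Fpow (carrier G) \<times> UNIV)"

definition refinements :: "('a \<times> bool) set set set" where
  "refinements = {\<T> \<in> \<Union>(range refinement_level). admissible \<T>}"

lemma refinements_refine:
  assumes "\<T> \<in> refinements" "finite C" "C \<subseteq> carrier G" "t \<in> \<T>" "finite E" "E \<subseteq> carrier G"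
    "admissible (refine \<T> C t E r)"
  shows "refine \<T> C t E r \<in> refinements"
proof -
  obtain n where "\<T> \<in> refinement_level n" using assms by (auto simp: refinements_def)
  moreover have "t \<in> patterns" using assms by (auto simp: refinements_def admissible_def)
  ultimately have "refine \<T> C t E r \<in> refinement_level (Suc n)"
    using assms by (auto simp: Fpow_def intro!: image_eqI[of _ _ "(\<T>, C, t, E, r)"])
  then show ?thesis using assms unfolding refinements_def by blast
qed

definition conditions :: "(('a \<times> bool) set \<times> ('a \<times> bool) set set) set" where
  "conditions = {(t, \<T>). \<T> \<in> refinements \<and> t \<in> \<T>}"

lemma countable_patterns:
  assumes "countable (carrier G)"
  shows "countable patterns"
proof -
  have "patterns \<subseteq> Fpow (carrier G \<times> UNIV)"
    by (auto simp: patterns_def Fpow_def graph_on_def)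
  moreover have "countable (carrier G \<times> (UNIV :: bool set))" using assms by simp
  ultimately show ?thesis using countable_Fpow countable_subset by blast
qed

lemma countable_conditions:
  assumes "countable (carrier G)"
  shows "countable conditions"
proof -
  have "countable (refinement_level n)" for n
    by (induction n) (use assms countable_patterns in \<open>auto intro!: countable_image countable_SIGMA countable_Fpow\<close>)
  then have "countable (\<Union>(range refinement_level))" by blast
  then have "countable refinements"
    by (rule countable_subset[rotated]) (auto simp: refinements_def)
  then have "countable (patterns \<times> refinements)"
    using countable_patterns[OF assms] by blast
  moreover have "conditions \<subseteq> patterns \<times> refinements"
    by (auto simp: conditions_def refinements_def admissible_def)
  ultimately show ?thesis using countable_subset by blast
qed

lemma conditionsD:
  assumes "(t, \<T>) \<in> conditions"
  shows "\<T> \<in> refinements" "t \<in> \<T>" "admissible \<T>" "t \<in> patterns"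
    "finite (supp t)" "supp t \<subseteq> carrier G"
    "\<And>s g. s \<in> \<T> \<Longrightarrow> g \<in> carrier G \<Longrightarrow> translate s g \<in> \<T>"
proof -
  show 1: "\<T> \<in> refinements" "t \<in> \<T>" "admissible \<T>"
    using assms by (auto simp: conditions_def refinements_def)
  then show 2: "t \<in> patterns"
    "\<And>s g. s \<in> \<T> \<Longrightarrow> g \<in> carrier G \<Longrightarrow> translate s g \<in> \<T>"
    unfolding admissible_def by blast+
  show "finite (supp t)" "supp t \<subseteq> carrier G" using pattern_props(2,3)[OF 2(1)] by auto
qed

definition below :: "('a \<times> bool) set \<times> ('a \<times> bool) set set \<Rightarrow> ('a \<times> bool) set \<times> ('a \<times> bool) set set \<Rightarrow> bool" where
  "below q p \<longleftrightarrow> fst p \<subseteq> fst q \<and> snd q \<subseteq> snd p"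

definition dense :: "(('a \<times> bool) set \<times> ('a \<times> bool) set set) set \<Rightarrow> bool" where
  "dense D \<longleftrightarrow> D \<subseteq> conditions \<and> (\<forall>p\<in>conditions. \<exists>q\<in>D. below q p)"

definition locally_in :: "('a \<times> bool) set set \<Rightarrow> ('a \<Rightarrow> bool) \<Rightarrow> bool" where
  "locally_in \<T> x \<longleftrightarrow> (\<forall>W. finite W \<and> W \<subseteq> carrier G \<longrightarrow>
     (\<exists>V. W \<subseteq> V \<and> graph_on x V \<in> \<T>))"

text \<open>
  A generic object is a point \<open>x\<close> together with a filter \<open>\<FF>\<close> of families. The point alone would not do: there
  is no reason for two conditions to be compatible because \<open>x\<close> belongs to both of their subshifts, whereas two conditions that hold at
  \<open>(x, \<FF>)\<close> have a common extension that holds there (\<open>holds_extend\<close>). The group acts on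
  the point and leaves \<open>\<FF>\<close> fixed.
\<close>
definition carries :: "('a \<times> bool) set set set \<Rightarrow> ('a \<Rightarrow> bool) \<Rightarrow> bool" where
  "carries \<FF> x \<longleftrightarrow> x \<in> topspace (shift_space G) \<and> \<FF> \<subseteq> refinements \<and>
     (\<forall>\<T>\<in>\<FF>. \<forall>\<T>'\<in>\<FF>. \<exists>\<S>\<in>\<FF>. \<S> \<subseteq> \<T> \<inter> \<T>') \<and>
     (\<forall>\<T>\<in>\<FF>. \<forall>\<T>'\<in>refinements. \<T> \<subseteq> \<T>' \<longrightarrow> \<T>' \<in> \<FF>) \<and>
     (\<forall>\<T>\<in>\<FF>. locally_in \<T> x)"

definition holds ::
  "('a \<times> bool) set set set \<Rightarrow> ('a \<Rightarrow> bool) \<Rightarrow> ('a \<times> bool) set \<times> ('a \<times> bool) set set \<Rightarrow> bool" where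
  "holds \<FF> x p \<longleftrightarrow> extends x (fst p) \<and> snd p \<in> \<FF>"

definition meets ::
  "('a \<times> bool) set set set \<Rightarrow> ('a \<Rightarrow> bool) \<Rightarrow> (('a \<times> bool) set \<times> ('a \<times> bool) set set) set set \<Rightarrow> bool" where
  "meets \<FF> x \<D> \<longleftrightarrow> (\<forall>D\<in>\<D>. \<exists>q\<in>D. holds \<FF> x q)"

lemma carriesD:
  assumes "carries \<FF> x"
  shows "x \<in> topspace (shift_space G)"
    and "\<T> \<in> \<FF> \<Longrightarrow> \<T> \<in> refinements"
    and "\<T> \<in> \<FF> \<Longrightarrow> admissible \<T>"
    and "\<T> \<in> \<FF> \<Longrightarrow> locally_in \<T> x"
    and "\<T> \<in> \<FF> \<Longrightarrow> \<T>' \<in> \<FF> \<Longrightarrow> \<exists>\<S>\<in>\<FF>. \<S> \<subseteq> \<T> \<inter> \<T>'"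
    and "\<T> \<in> \<FF> \<Longrightarrow> \<T>' \<in> refinements \<Longrightarrow> \<T> \<subseteq> \<T>' \<Longrightarrow> \<T>' \<in> \<FF>"
proof -
  note * = assms[unfolded carries_def]
  show "x \<in> topspace (shift_space G)" using * by simp
  show "\<T> \<in> refinements" if "\<T> \<in> \<FF>" using * that by auto
  then show "admissible \<T>" if "\<T> \<in> \<FF>" using that by (simp add: refinements_def)
  show "locally_in \<T> x" if "\<T> \<in> \<FF>" using * that by simp
  show "\<exists>\<S>\<in>\<FF>. \<S> \<subseteq> \<T> \<inter> \<T>'" if "\<T> \<in> \<FF>" "\<T>' \<in> \<FF>" using * that by simp
  show "\<T>' \<in> \<FF>" if "\<T> \<in> \<FF>" "\<T>' \<in> refinements" "\<T> \<subseteq> \<T>'" using * that by simp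
qed

lemma below_refl: "below p p" and below_trans: "below r q \<Longrightarrow> below q p \<Longrightarrow> below r p"
  by (auto simp: below_def)

lemma meetsD: "meets \<FF> x \<D> \<Longrightarrow> D \<in> \<D> \<Longrightarrow> \<exists>q\<in>D. holds \<FF> x q"
  by (simp add: meets_def)

lemma meets_subset: "meets \<FF> x \<D> \<Longrightarrow> \<E> \<subseteq> \<D> \<Longrightarrow> meets \<FF> x \<E>"
  by (auto simp: meets_def)

lemma locally_in_mono: "locally_in \<S> x \<Longrightarrow> \<S> \<subseteq> \<T> \<Longrightarrow> locally_in \<T> x"
  unfolding locally_in_def by (meson subsetD)

lemma holds_mono:
  assumes "carries \<FF> x" "holds \<FF> x q" "below q p" "p \<in> conditions"
  shows "holds \<FF> x p"
proof -
  have "snd p \<in> refinements" using assms(4) by (auto simp: conditions_def)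
  then have "snd p \<in> \<FF>" using carriesD(6)[OF assms(1), of "snd q" "snd p"] assms(2,3)
    by (simp add: holds_def below_def)
  then show ?thesis using assms(2,3) extends_mono unfolding holds_def below_def by blast
qed

text \<open>
  A family below the two given ones is found in the filter, and a pattern above the two given ones among the
  restrictions of \<open>x\<close>.
\<close>
lemma holds_extend:
  assumes "carries \<FF> x" "holds \<FF> x p" "holds \<FF> x q" "p \<in> conditions" "q \<in> conditions"
    and W: "finite W" "W \<subseteq> carrier G"
  obtains s \<S> where "(s, \<S>) \<in> conditions" "holds \<FF> x (s, \<S>)" "below (s, \<S>) p" "below (s, \<S>) q"
    "W \<subseteq> supp s"
proof -
  obtain \<S> where \<S>: "\<S> \<in> \<FF>" "\<S> \<subseteq> snd p \<inter> snd q"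
    using carriesD(5)[OF assms(1), of "snd p" "snd q"] assms(2,3) by (auto simp: holds_def)
  have fin: "finite (supp (fst p) \<union> supp (fst q) \<union> W)" "supp (fst p) \<union> supp (fst q) \<union> W \<subseteq> carrier G"
    using conditionsD(5,6)[of "fst p" "snd p"] conditionsD(5,6)[of "fst q" "snd q"] assms(4,5) W by auto
  have "locally_in \<S> x" using \<S>(1) assms(1) carriesD(4) by blast
  then obtain V where V: "supp (fst p) \<union> supp (fst q) \<union> W \<subseteq> V" "graph_on x V \<in> \<S>"
    using fin unfolding locally_in_def by meson
  have "\<S> \<in> refinements" using \<S>(1) assms(1) carriesD(2) by blast
  then have "(graph_on x V, \<S>) \<in> conditions" using V by (simp add: conditions_def)
  moreover have "holds \<FF> x (graph_on x V, \<S>)" using \<S> by (simp add: holds_def extends_graph_on)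
  moreover have "below (graph_on x V, \<S>) p" "below (graph_on x V, \<S>) q"
    using \<S>(2) V(1) assms(2,3) by (auto simp: below_def subset_graph_on holds_def)
  ultimately show ?thesis using that V by simp
qed

lemma extends_shift:
  assumes "supp t \<subseteq> carrier G" "g \<in> carrier G" "x \<in> topspace (shift_space G)"
  shows "extends (shift G g x) t \<longleftrightarrow> extends x (translate t g)"
proof -
  have "shift G g x v = x (v \<otimes> g)" if "(v, b) \<in> t" for v b
    using suppI[OF that] assms by (auto simp: shift_def)
  then show ?thesis unfolding extends_def translate_def by fastforce
qed

lemma carries_shift:
  assumes "carries \<FF> x" "g \<in> carrier G"
  shows "carries \<FF> (shift G g x)"
proof -
  have x: "x \<in> topspace (shift_space G)" using assms by (simp add: carries_def)
  have "locally_in \<T> (shift G g x)" if \<T>: "\<T> \<in> \<FF>" for \<T>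
    unfolding locally_in_def
  proof (intro allI impI)
    fix W assume W: "finite W \<and> W \<subseteq> carrier G"
    have adm: "admissible \<T>" "locally_in \<T> x"
      using \<T> assms(1) carriesD(3,4) by blast+
    have "finite (W #> g)" "W #> g \<subseteq> carrier G" using W assms(2) by (auto simp: r_coset_def)
    then obtain V where V: "W #> g \<subseteq> V" "graph_on x V \<in> \<T>"
      using adm(2) unfolding locally_in_def by blast
    have Vc: "V \<subseteq> carrier G"
      using pattern_props(3)[of "graph_on x V"] V(2) adm(1) unfolding admissible_def by auto
    have "translate (graph_on x V) (inv g) \<in> \<T>"
      using V(2) adm(1) assms(2) unfolding admissible_def by blast
    also have "translate (graph_on x V) (inv g) = graph_on (\<lambda>v. x (v \<otimes> g)) (V #> inv g)"
      using translate_graph_on[OF Vc, of "inv g" x] assms(2) by simp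
    also have "\<dots> = graph_on (shift G g x) (V #> inv g)"
      using r_coset_subset_G[OF Vc, of "inv g"] assms(2) x
      by (auto simp: graph_on_def shift_def intro!: image_cong)
    finally have "graph_on (shift G g x) (V #> inv g) \<in> \<T>" .
    moreover have "W \<subseteq> V #> inv g"
    proof
      fix v assume v: "v \<in> W"
      then have vc: "v \<in> carrier G" using W by blast
      have "v \<otimes> g \<in> V" using v V(1) unfolding r_coset_def by blast
      moreover have "v = (v \<otimes> g) \<otimes> inv g" using vc assms(2) by (simp add: m_assoc)
      ultimately show "v \<in> V #> inv g" unfolding mem_r_coset by blast
    qed
    ultimately show "\<exists>V. W \<subseteq> V \<and> graph_on (shift G g x) V \<in> \<T>" by blast
  qed
  then show ?thesis
    using assms(1) shift_closed[OF x] unfolding carries_def by simp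
qed

lemma nontrivial_element:
  assumes "infinite (carrier G)"
  obtains g where "g \<in> carrier G" "g \<noteq> \<one>"
proof -
  have "\<not> carrier G \<subseteq> {\<one>}" using assms finite_subset by blast
  then show ?thesis using that by blast
qed

text \<open>
  Besides deciding finitely many values, an extension can be taken to differ from its shift by \<open>g\<close>. The hole
  \<open>w\<close> is any point outside the finite support of \<open>t\<close>.
\<close>
lemma condition_extension:
  assumes inf: "infinite (carrier G)" and p: "(t, \<T>) \<in> conditions" and W: "finite W" "W \<subseteq> carrier G"
    and g: "g \<in> carrier G" "g \<noteq> \<one>"
  obtains s w b where "(s, \<T>) \<in> conditions" "t \<subseteq> s" "W \<subseteq> supp s"
    "w \<in> carrier G" "(w, b) \<in> s" "(w \<otimes> g, \<not> b) \<in> s"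
proof -
  have "\<exists>w\<in>carrier G. w \<notin> supp t"
    using inf conditionsD(5)[OF p] by (meson finite_subset subsetI)
  then obtain w where w: "w \<in> carrier G" "w \<notin> supp t" by blast
  have "finite (insert w (insert (w \<otimes> g) W))" "insert w (insert (w \<otimes> g) W) \<subseteq> carrier G"
    using W w g by auto
  then obtain x V where V: "graph_on x V \<in> \<T>" "t \<subseteq> graph_on x V"
      "insert w (insert (w \<otimes> g) W) \<subseteq> V" "x (w \<otimes> g) \<noteq> x w"
    using admissible_extension[OF conditionsD(3)[OF p] conditionsD(2)[OF p] _ _ w g] by metis
  have "(w, x w) \<in> graph_on x V" "(w \<otimes> g, \<not> x w) \<in> graph_on x V"
    using V(3,4) by (auto simp: graph_on_def)
  moreover have "(graph_on x V, \<T>) \<in> conditions"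
    using V(1) conditionsD(1)[OF p] by (simp add: conditions_def)
  ultimately show ?thesis using that V w by auto
qed

lemma conditions_nonempty:
  assumes "infinite (carrier G)" "\<T> \<in> refinements"
  shows "\<exists>t. (t, \<T>) \<in> conditions"
proof -
  obtain g where g: "g \<in> carrier G" "g \<noteq> \<one>" using nontrivial_element[OF assms(1)] .
  obtain K where "plantable \<T> K" using assms(2) unfolding refinements_def admissible_def by blast
  then have *: "F \<subseteq> \<T> \<and> disjoint_family_on (\<lambda>s. K <#> supp s) F \<and>
     (\<forall>b\<in>B. finite b \<and> b \<subseteq> carrier G) \<and> disjoint_family_on (\<lambda>b. K <#> b) B \<and>
     (\<forall>s\<in>F. \<exists>b\<in>B. K <#> supp s \<subseteq> b) \<and>
     w \<in> carrier G \<and> (\<forall>s\<in>F. w \<notin> supp s) \<and> g \<in> carrier G \<and> g \<noteq> \<one> \<longrightarrow>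
     (\<exists>x. (\<forall>s\<in>F. extends x s) \<and> x (w \<otimes> g) \<noteq> x w \<and>
        (\<forall>W. finite W \<and> W \<subseteq> carrier G \<longrightarrow>
          (\<exists>V. finite V \<and> V \<subseteq> carrier G \<and> W \<subseteq> V \<and> graph_on x V \<in> \<T> \<and>
             (\<forall>b\<in>B. b \<inter> V \<noteq> {} \<longrightarrow> b \<subseteq> V))))" for F B w
    unfolding plantable_def by (elim allE)
  obtain x where "\<forall>W. finite W \<and> W \<subseteq> carrier G \<longrightarrow>
          (\<exists>V. finite V \<and> V \<subseteq> carrier G \<and> W \<subseteq> V \<and> graph_on x V \<in> \<T> \<and>
             (\<forall>b\<in>{}. b \<inter> V \<noteq> {} \<longrightarrow> b \<subseteq> V))"
    using *[of "{}" "{}" \<one>] g by (auto simp: disjoint_family_on_def)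
  from spec[OF this, of "{}"] obtain V where "graph_on x V \<in> \<T>" by auto
  then show ?thesis using assms(2) unfolding conditions_def by blast
qed

text \<open>
  The Rasiowa-Sikorski lemma. A descending sequence of conditions meets the given dense sets and
  decides the value at every group element. Its patterns unite to the point, and its families generate the filter.
\<close>
lemma generic_exists:
  assumes cnt: "countable (carrier G)" and inf: "infinite (carrier G)"
    and \<D>: "countable \<D>" "\<And>D. D \<in> \<D> \<Longrightarrow> dense D" and p: "p \<in> conditions"
  obtains \<FF> x where "carries \<FF> x" "holds \<FF> x p" "meets \<FF> x \<D>"
proof -
  define decide where "decide v = {q \<in> conditions. v \<in> supp (fst q)}" for v
  have dense_decide: "dense (decide v)" if v: "v \<in> carrier G" for v
    unfolding dense_def
  proof (intro conjI ballI)
    fix q assume q: "q \<in> conditions"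
    obtain g where g: "g \<in> carrier G" "g \<noteq> \<one>" using nontrivial_element[OF inf] .
    obtain s w b where "(s, snd q) \<in> conditions" "fst q \<subseteq> s" "{v} \<subseteq> supp s"
      using condition_extension[OF inf, of "fst q" "snd q" "{v}" g] q v g by auto
    then show "\<exists>r\<in>decide v. below r q"
      by (intro bexI[of _ "(s, snd q)"]) (auto simp: decide_def below_def)
  qed (auto simp: decide_def)
  define \<E> where "\<E> = \<D> \<union> decide ` carrier G"
  have \<E>: "countable \<E>" "\<E> \<noteq> {}" "\<And>D. D \<in> \<E> \<Longrightarrow> dense D"
    using \<D> cnt dense_decide by (auto simp: \<E>_def)
  define d where "d = from_nat_into \<E>"
  have d: "dense (d n)" for n using \<E> by (simp add: d_def from_nat_into)
  \<comment> \<open>Step \<open>n\<close> moves into the \<open>n\<close>-th dense set.\<close>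
  define Q where "Q = rec_nat p (\<lambda>n q. SOME r. r \<in> d n \<and> below r q)"
  have Q0: "Q 0 = p" by (simp add: Q_def)
  have QS: "Q (Suc n) \<in> d n \<and> below (Q (Suc n)) (Q n)" if "Q n \<in> conditions" for n
  proof -
    have "\<exists>r. r \<in> d n \<and> below r (Q n)" using d[of n] that unfolding dense_def by blast
    from someI_ex[OF this] show ?thesis by (simp add: Q_def)
  qed
  have Qc: "Q n \<in> conditions" for n
  proof (induction n)
    case (Suc n)
    then show ?case using QS[OF Suc] d[of n] unfolding dense_def by blast
  qed (simp add: Q0 p)
  have QS: "Q (Suc n) \<in> d n" "below (Q (Suc n)) (Q n)" for n using QS[OF Qc] by auto
  have Qle: "below (Q n) (Q m)" if "m \<le> n" for m n
    using that by (induction n rule: dec_induct) (auto intro: below_refl below_trans QS(2))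
  have Qpatt: "fst (Q n) \<in> patterns" "supp (fst (Q n)) \<subseteq> carrier G" "fst (Q n) \<in> snd (Q n)" for n
    using conditionsD(2,4,6)[of "fst (Q n)" "snd (Q n)"] Qc[of n] by auto
  define x where "x = (\<lambda>v\<in>carrier G. \<exists>n. (v, True) \<in> fst (Q n))"
  have x: "x \<in> topspace (shift_space G)" by (simp add: topspace_shift_space x_def)
  have ext: "extends x (fst (Q n))" for n
    unfolding extends_def
  proof (intro ballI, clarify)
    fix v b assume vb: "(v, b) \<in> fst (Q n)"
    have vc: "v \<in> carrier G" using suppI[OF vb] Qpatt(2) by blast
    have "b" if "(v, True) \<in> fst (Q m)" for m
    proof -
      have "(v, b) \<in> fst (Q (max m n))" "(v, True) \<in> fst (Q (max m n))"
        using vb that Qle[of n "max m n"] Qle[of m "max m n"] by (auto simp: below_def)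
      then show ?thesis using pattern_props(4)[OF Qpatt(1)] by blast
    qed
    then have "(\<exists>m. (v, True) \<in> fst (Q m)) = b" using vb by (cases b) auto
    then show "x v = b" using vc by (simp add: x_def)
  qed
  define \<FF> where "\<FF> = {\<T> \<in> refinements. \<exists>n. snd (Q n) \<subseteq> \<T>}"
  have snd_in: "snd (Q n) \<in> \<FF>" for n
    using Qc[of n] by (auto simp: \<FF>_def conditions_def)
  have hits: "\<exists>q\<in>D. holds \<FF> x q" if D: "D \<in> \<E>" for D
  proof -
    obtain n where "D = d n"
      using D \<E> by (metis d_def from_nat_into_surj)
    then have "Q (Suc n) \<in> D" using QS by simp
    moreover have "holds \<FF> x (Q (Suc n))" using ext snd_in by (simp add: holds_def)
    ultimately show ?thesis by blast
  qed
  have decided: "\<exists>n. W \<subseteq> supp (fst (Q n))" if "finite W" "W \<subseteq> carrier G" for W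
    using that
  proof (induction W rule: finite_induct)
    case (insert v W)
    then obtain n where n: "W \<subseteq> supp (fst (Q n))" by auto
    have "decide v \<in> \<E>" using insert by (auto simp: \<E>_def)
    then obtain m where "d m = decide v"
      using \<E> by (metis d_def from_nat_into_surj)
    then have "v \<in> supp (fst (Q (Suc m)))" using QS(1)[of m] by (simp add: decide_def)
    then have "insert v W \<subseteq> supp (fst (Q (max n (Suc m))))"
      using n Qle[of n "max n (Suc m)"] Qle[of "Suc m" "max n (Suc m)"] supp_mono
      unfolding below_def by (meson insert_subset max.cobounded1 max.cobounded2 subset_trans subsetD)
    then show ?case by blast
  qed simp
  have loc: "locally_in (snd (Q n)) x" for n
    unfolding locally_in_def
  proof (intro allI impI)
    fix W assume W: "finite W \<and> W \<subseteq> carrier G"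
    then obtain m where m: "W \<subseteq> supp (fst (Q m))" using decided by blast
    let ?k = "max m n"
    have "W \<subseteq> supp (fst (Q ?k))"
      using m Qle[of m ?k] supp_mono unfolding below_def by (meson max.cobounded1 subset_trans)
    moreover have "graph_on x (supp (fst (Q ?k))) = fst (Q ?k)"
      using extends_imp_eq[OF ext] by metis
    moreover have "fst (Q ?k) \<in> snd (Q n)"
      using Qpatt(3)[of ?k] Qle[of n ?k] by (auto simp: below_def)
    ultimately show "\<exists>V. W \<subseteq> V \<and> graph_on x V \<in> snd (Q n)" by metis
  qed
  have "carries \<FF> x"
    unfolding carries_def
  proof (intro conjI ballI impI)
    show "\<exists>\<S>\<in>\<FF>. \<S> \<subseteq> \<T> \<inter> \<T>'" if T: "\<T> \<in> \<FF>" "\<T>' \<in> \<FF>" for \<T> \<T>'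
    proof -
      obtain m n where "snd (Q m) \<subseteq> \<T>" "snd (Q n) \<subseteq> \<T>'" using T by (auto simp: \<FF>_def)
      then have "snd (Q (max m n)) \<subseteq> \<T> \<inter> \<T>'"
        using Qle[of m "max m n"] Qle[of n "max m n"] by (auto simp: below_def)
      then show ?thesis using snd_in by blast
    qed
    show "locally_in \<T> x" if "\<T> \<in> \<FF>" for \<T>
      using that loc locally_in_mono by (auto simp: \<FF>_def)
  qed (use x in \<open>auto simp: \<FF>_def\<close>)
  moreover have "holds \<FF> x p" using ext[of 0] snd_in[of 0] by (simp add: holds_def Q0)
  moreover have "meets \<FF> x \<D>" using hits by (auto simp: meets_def \<E>_def)
  ultimately show ?thesis by (rule that)
qed

text \<open>
  Translating the patterns in a dense set gives a dense set, since the families are right-invariant. So genericity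
  for the countably many translates of the dense sets makes all translates of the point generic.
  Freeness comes from the dense sets \<open>asym g\<close>.
\<close>
lemma fully_generic_exists:
  assumes cnt: "countable (carrier G)" and inf: "infinite (carrier G)"
    and \<D>: "countable \<D>" "\<And>D. D \<in> \<D> \<Longrightarrow> dense D" and p: "p \<in> conditions"
  obtains \<FF> x where "carries \<FF> x" "holds \<FF> x p" "x \<in> free_part G"
    "\<forall>g\<in>carrier G. meets \<FF> (shift G g x) \<D>"
proof -
  let ?tr = "\<lambda>g (t, \<T> :: ('a \<times> bool) set set). (translate t g, \<T>)"
  define asym where "asym g = {q \<in> conditions. \<exists>w b. w \<in> carrier G \<and> (w, b) \<in> fst q \<and> (w \<otimes> g, \<not> b) \<in> fst q}" for g
  have dense_asym: "dense (asym g)" if g: "g \<in> carrier G" "g \<noteq> \<one>" for g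
    unfolding dense_def
  proof (intro conjI ballI)
    fix q assume q: "q \<in> conditions"
    obtain s w b where s: "(s, snd q) \<in> conditions" "fst q \<subseteq> s"
      "w \<in> carrier G" "(w, b) \<in> s" "(w \<otimes> g, \<not> b) \<in> s"
      using condition_extension[OF inf, of "fst q" "snd q" "{}" g] q g by auto
    then show "\<exists>r\<in>asym g. below r q"
      by (intro bexI[of _ "(s, snd q)"]) (auto simp: asym_def below_def)
  qed (auto simp: asym_def)
  have tr_conditions: "?tr g q \<in> conditions" if "q \<in> conditions" "g \<in> carrier G" for q g
  proof -
    have q: "(fst q, snd q) \<in> conditions" using that by simp
    then have "(translate (fst q) g, snd q) \<in> conditions"
      using conditionsD(1)[OF q] conditionsD(7)[OF q conditionsD(2)[OF q] that(2)]
      unfolding conditions_def by blast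
    then show ?thesis by (simp add: split_beta)
  qed
  have dense_tr: "dense (?tr g ` D)" if D: "dense D" and g: "g \<in> carrier G" for D g
    unfolding dense_def
  proof (intro conjI ballI)
    show "?tr g ` D \<subseteq> conditions"
      using D tr_conditions[OF _ g] unfolding dense_def by blast
    fix q assume q: "q \<in> conditions"
    have q': "(fst q, snd q) \<in> conditions" using q by simp
    have "(translate (fst q) (inv g), snd q) \<in> conditions"
      using tr_conditions[OF q, of "inv g"] g by (simp add: split_beta)
    then obtain r where r: "r \<in> D" "below r (translate (fst q) (inv g), snd q)"
      using D unfolding dense_def by blast
    have "translate (translate (fst q) (inv g)) g \<subseteq> translate (fst r) g"
      using r(2) translate_mono by (simp add: below_def)
    moreover have "translate (translate (fst q) (inv g)) g = fst q"
      using translate_translate[OF conditionsD(6)[OF q'], of "inv g" g] g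
        translate_one[OF conditionsD(6)[OF q']] by simp
    ultimately have "below (?tr g r) q" using r(2) by (simp add: below_def split_beta)
    then show "\<exists>r\<in>?tr g ` D. below r q" using r(1) by blast
  qed
  let ?E = "(\<Union>g\<in>carrier G. (\<lambda>D. ?tr g ` D) ` \<D>) \<union> asym ` (carrier G - {\<one>})"
  have "countable ?E" using cnt \<D>(1) by (intro countable_Un countable_UN countable_image) auto
  moreover have "dense D" if "D \<in> ?E" for D
  proof -
    from that consider g D' where "g \<in> carrier G" "D' \<in> \<D>" "D = ?tr g ` D'"
      | g where "g \<in> carrier G" "g \<noteq> \<one>" "D = asym g"
      by blast
    then show ?thesis using dense_tr \<D>(2) dense_asym by cases blast+
  qed
  ultimately obtain \<FF> x where x: "carries \<FF> x" "holds \<FF> x p" and m: "meets \<FF> x ?E"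
    by (rule generic_exists[OF cnt inf _ _ p, of ?E])
  have xs: "x \<in> topspace (shift_space G)" using carriesD(1)[OF x(1)] .
  have "shift G g x \<noteq> x" if g: "g \<in> carrier G" "g \<noteq> \<one>" for g
  proof -
    have "asym g \<in> ?E" using g by blast
    then obtain q where q: "q \<in> asym g" "holds \<FF> x q" using meetsD[OF m] by blast
    then obtain w b where wb: "w \<in> carrier G" "(w, b) \<in> fst q" "(w \<otimes> g, \<not> b) \<in> fst q"
      by (auto simp: asym_def)
    have "extends x (fst q)" using q(2) by (simp add: holds_def)
    then have "x w = b" "x (w \<otimes> g) = (\<not> b)" using wb extendsD by metis+
    then have "shift G g x w \<noteq> x w" using xs g wb(1) by (simp add: shift_def)
    then show ?thesis by auto
  qed
  then have "x \<in> free_part G"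
    using xs shift_one[OF xs] by (auto simp: free_part_def stabilizer_def)
  moreover have "meets \<FF> (shift G g x) \<D>" if g: "g \<in> carrier G" for g
    unfolding meets_def
  proof
    fix D assume D: "D \<in> \<D>"
    have "?tr g ` D \<in> ?E" using D g by blast
    from meetsD[OF m this] obtain q where q: "q \<in> D" "holds \<FF> x (?tr g q)" by (elim bexE imageE) simp
    have "q \<in> conditions" using q(1) \<D>(2)[OF D] unfolding dense_def by blast
    then have "supp (fst q) \<subseteq> carrier G" using conditionsD(6)[of "fst q" "snd q"] by simp
    then have "holds \<FF> (shift G g x) q"
      using q(2) extends_shift[OF _ g xs] by (simp add: holds_def split_beta)
    then show "\<exists>q\<in>D. holds \<FF> (shift G g x) q" using q(1) by blast
  qed
  ultimately show ?thesis using that x by blast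
qed

section \<open>Borel sets are decided\<close>

text \<open>
  This plays the part of \<open>A\<close> being comeagre in the open set given by \<open>p\<close>; the countably many dense sets
  witness it.
\<close>
definition forces :: "('a \<times> bool) set \<times> ('a \<times> bool) set set \<Rightarrow> ('a \<Rightarrow> bool) set \<Rightarrow> bool" where
  "forces p A \<longleftrightarrow> (\<exists>\<D>. countable \<D> \<and> (\<forall>D\<in>\<D>. dense D) \<and>
     (\<forall>\<FF> x. carries \<FF> x \<and> holds \<FF> x p \<and> meets \<FF> x \<D> \<longrightarrow> x \<in> A))"

definition decided :: "('a \<Rightarrow> bool) set \<Rightarrow> bool" where
  "decided A \<longleftrightarrow> (\<forall>p\<in>conditions. \<exists>q\<in>conditions. below q p \<and>
     (forces q A \<or> forces q (topspace (shift_space G) - A)))"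

lemma forcesI:
  assumes "\<And>\<FF> x. carries \<FF> x \<Longrightarrow> holds \<FF> x p \<Longrightarrow> x \<in> A"
  shows "forces p A"
  unfolding forces_def by (rule exI[of _ "{}"]) (use assms in auto)

lemma forces_mono:
  assumes "forces p A" "below q p" "p \<in> conditions"
    and "A \<inter> topspace (shift_space G) \<subseteq> B"
  shows "forces q B"
proof -
  obtain \<D> where \<D>: "countable \<D>" "\<forall>D\<in>\<D>. dense D"
    "\<And>\<FF> x. carries \<FF> x \<Longrightarrow> holds \<FF> x p \<Longrightarrow> meets \<FF> x \<D> \<Longrightarrow> x \<in> A"
    using assms(1) unfolding forces_def by metis
  have "x \<in> B" if "carries \<FF> x" "holds \<FF> x q" "meets \<FF> x \<D>" for \<FF> x
    using \<D>(3)[OF that(1) holds_mono[OF that(1,2) assms(2,3)] that(3)] carriesD(1)[OF that(1)] assms(4)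
    by blast
  then show ?thesis unfolding forces_def using \<D>(1,2) by blast
qed

text \<open>
  If a generic point of \<open>p\<close> is in \<open>U\<close>, a finite part of it keeps all its extensions in \<open>U\<close>, and this finite
  part belongs to a condition below \<open>p\<close>.
\<close>
lemma decided_open:
  assumes "openin (shift_space G) U"
  shows "decided U"
  unfolding decided_def
proof
  fix p assume p: "p \<in> conditions"
  show "\<exists>q\<in>conditions. below q p \<and> (forces q U \<or> forces q (topspace (shift_space G) - U))"
  proof (cases "\<exists>q\<in>conditions. below q p \<and> forces q U")
    case False
    have "forces p (topspace (shift_space G) - U)"
    proof (rule forcesI)
      fix \<FF> x assume x: "carries \<FF> x" "holds \<FF> x p"
      have xs: "x \<in> topspace (shift_space G)" using carriesD(1)[OF x(1)] .
      have "x \<notin> U"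
      proof
        assume "x \<in> U"
        then have "\<exists>N. finite {i \<in> carrier G. N i \<noteq> topspace (discrete_topology (UNIV :: bool set))} \<and>
            (\<forall>i\<in>carrier G. openin (discrete_topology UNIV) (N i)) \<and>
            x \<in> Pi\<^sub>E (carrier G) N \<and> Pi\<^sub>E (carrier G) N \<subseteq> U"
          by (rule assms[unfolded shift_space_def openin_product_topology_alt, THEN bspec])
        then obtain N where N: "finite {i \<in> carrier G. N i \<noteq> (UNIV :: bool set)}"
            "x \<in> Pi\<^sub>E (carrier G) N" "Pi\<^sub>E (carrier G) N \<subseteq> U"
          unfolding topspace_discrete_topology by (elim exE conjE)
        have Nc: "{i \<in> carrier G. N i \<noteq> UNIV} \<subseteq> carrier G" by blast
        obtain s \<S> where s: "(s, \<S>) \<in> conditions" "holds \<FF> x (s, \<S>)" "below (s, \<S>) p"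
            "below (s, \<S>) p" "{i \<in> carrier G. N i \<noteq> UNIV} \<subseteq> supp s"
          by (rule holds_extend[OF x(1) x(2) x(2) p p N(1) Nc])
        have "forces (s, \<S>) U"
        proof (rule forcesI)
          fix \<FF>' y assume y: "carries \<FF>' y" "holds \<FF>' y (s, \<S>)"
          have ys: "y \<in> topspace (shift_space G)" using carriesD(1)[OF y(1)] .
          have "y i \<in> N i" if i: "i \<in> carrier G" for i
          proof (cases "N i = UNIV")
            case False
            then have "i \<in> supp s" using s(5) i by blast
            then obtain b where "(i, b) \<in> s" by (auto simp: supp_def)
            then have "y i = b" "x i = b" using y(2) s(2) by (auto simp: holds_def extends_def)
            then show ?thesis using PiE_mem[OF N(2) i] by simp
          qed simp
          then have "y \<in> Pi\<^sub>E (carrier G) N" using ys by (auto simp: topspace_shift_space PiE_def)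
          then show "y \<in> U" using N(3) by blast
        qed
        then show False using False s by blast
      qed
      then show "x \<in> topspace (shift_space G) - U" using xs by blast
    qed
    then show ?thesis using p below_refl by blast
  qed blast
qed

text \<open>
  If nothing below \<open>p\<close> forces membership in one of the sets, generic points of \<open>p\<close> satisfy for each \<open>i\<close> a condition
  that forces non-membership in \<open>a i\<close>: one that forces membership would have a common extension with \<open>p\<close>. The
  witnesses for these conditions are collected over all conditions, so it matters that there are only countably many.
\<close>
lemma decided_Union:
  assumes cnt: "countable (carrier G)" and a: "\<And>i::nat. decided (a i)"
  shows "decided (\<Union>i. a i)"
  unfolding decided_def
proof
  let ?X = "topspace (shift_space G)"
  fix p assume p: "p \<in> conditions"
  show "\<exists>q\<in>conditions. below q p \<and> (forces q (\<Union>i. a i) \<or> forces q (?X - (\<Union>i. a i)))"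
  proof (cases "\<exists>q\<in>conditions. \<exists>i. below q p \<and> forces q (a i)")
    case True
    then obtain q i where q: "q \<in> conditions" "below q p" "forces q (a i)" by blast
    then have "forces q (\<Union>i. a i)"
      by (intro forces_mono[OF q(3) below_refl q(1)]) blast
    then show ?thesis using q by blast
  next
    case no: False
    define D where "D i = {q \<in> conditions. forces q (a i) \<or> forces q (?X - a i)}" for i
    have D: "dense (D i)" for i
      using a[of i] unfolding decided_def dense_def D_def by blast
    have "\<forall>z. \<exists>\<D>. forces (fst z) (?X - a (snd z)) \<longrightarrow> countable \<D> \<and> (\<forall>D\<in>\<D>. dense D) \<and>
       (\<forall>\<FF> x. carries \<FF> x \<and> holds \<FF> x (fst z) \<and> meets \<FF> x \<D> \<longrightarrow> x \<in> ?X - a (snd z))"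
      unfolding forces_def by blast
    then obtain \<D> where \<D>: "\<And>q i. forces q (?X - a i) \<Longrightarrow> countable (\<D> (q, i)) \<and> (\<forall>D\<in>\<D> (q, i). dense D) \<and>
       (\<forall>\<FF> x. carries \<FF> x \<and> holds \<FF> x q \<and> meets \<FF> x (\<D> (q, i)) \<longrightarrow> x \<in> ?X - a i)"
      by (metis fst_conv snd_conv)
    define Z where "Z = {(q, i). q \<in> conditions \<and> forces q (?X - a i)}"
    have "countable (conditions \<times> (UNIV :: nat set))"
      using countable_conditions[OF cnt] by blast
    then have Z: "countable Z" by (rule countable_subset[rotated]) (auto simp: Z_def)
    let ?E = "range D \<union> (\<Union>z\<in>Z. \<D> z)"
    have E: "countable ?E" "\<forall>D\<in>?E. dense D"
      using Z \<D> D by (auto simp: Z_def intro!: countable_UN)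
    have "x \<in> ?X - (\<Union>i. a i)" if x: "carries \<FF> x" "holds \<FF> x p" "meets \<FF> x ?E" for \<FF> x
    proof -
      have "x \<notin> a i" for i
      proof -
        have "D i \<in> ?E" by blast
        from meetsD[OF x(3) this] obtain q where q: "q \<in> D i" "holds \<FF> x q" by blast
        have qc: "q \<in> conditions" using q(1) by (simp add: D_def)
        have "\<not> forces q (a i)"
        proof
          assume f: "forces q (a i)"
          obtain s \<S> where s: "(s, \<S>) \<in> conditions" "below (s, \<S>) p" "below (s, \<S>) q"
            using holds_extend[OF x(1,2) q(2) p qc, of "{}"] by blast
          have "forces (s, \<S>) (a i)" by (rule forces_mono[OF f s(3) qc]) blast
          then show False using no s by blast
        qed
        then have f: "forces q (?X - a i)" using q(1) by (simp add: D_def)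
        then have "\<D> (q, i) \<subseteq> ?E" using qc by (auto simp: Z_def)
        with x(3) have "meets \<FF> x (\<D> (q, i))" by (rule meets_subset)
        then show ?thesis using \<D>[OF f] x(1) q(2) by blast
      qed
      then show ?thesis using carriesD(1)[OF x(1)] by blast
    qed
    then have "forces p (?X - (\<Union>i. a i))" unfolding forces_def using E by blast
    then show ?thesis using p below_refl by blast
  qed
qed

lemma decided_borel:
  assumes "countable (carrier G)" "A \<in> borel_sets_of (shift_space G)"
  shows "decided A"
  using assms(2) unfolding borel_sets_of_def
proof (induction rule: sigma_sets.induct)
  case (Basic a)
  then show ?case using decided_open by simp
next
  case Empty
  then show ?case by (rule decided_open) simp
next
  case (Compl a)
  let ?X = "topspace (shift_space G)"
  have "forces q (?X - (?X - a))" if "forces q a" "q \<in> conditions" for q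
    by (rule forces_mono[OF that(1) below_refl that(2)]) blast
  then show ?case using Compl.IH unfolding decided_def by blast
next
  case (Union a)
  then show ?case using decided_Union[OF assms(1)] by blast
qed

section \<open>Trapping a point\<close>

text \<open>
  Otherwise densely many conditions force non-membership in \<open>B\<close>. A free point all of whose translates are generic
  then has an orbit disjoint from \<open>B\<close>, against the assumption that \<open>B\<close> is a complete section.
\<close>
lemma section_forced:
  assumes cnt: "countable (carrier G)" and inf: "infinite (carrier G)"
    and B: "B \<in> borel_sets_of (shift_space G)" "complete_section G B"
  shows "\<exists>p\<in>conditions. forces p B"
proof (rule ccontr)
  let ?X = "topspace (shift_space G)"
  assume no: "\<not> (\<exists>p\<in>conditions. forces p B)"
  have "\<exists>q\<in>conditions. below q p \<and> forces q (?X - B)" if p: "p \<in> conditions" for p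
  proof -
    obtain q where q: "q \<in> conditions" "below q p" "forces q B \<or> forces q (?X - B)"
      using decided_borel[OF cnt B(1), unfolded decided_def, THEN bspec, OF p] by (elim bexE conjE)
    moreover have "\<not> forces q B" using no q(1) by blast
    ultimately show ?thesis by blast
  qed
  then have D: "dense {q \<in> conditions. forces q (?X - B)}" unfolding dense_def by blast
  have "\<forall>q. \<exists>\<D>. forces q (?X - B) \<longrightarrow> countable \<D> \<and> (\<forall>D\<in>\<D>. dense D) \<and>
       (\<forall>\<FF> x. carries \<FF> x \<and> holds \<FF> x q \<and> meets \<FF> x \<D> \<longrightarrow> x \<in> ?X - B)"
    unfolding forces_def by blast
  then obtain \<D> where \<D>: "\<And>q. forces q (?X - B) \<Longrightarrow> countable (\<D> q) \<and> (\<forall>D\<in>\<D> q. dense D) \<and>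
       (\<forall>\<FF> x. carries \<FF> x \<and> holds \<FF> x q \<and> meets \<FF> x (\<D> q) \<longrightarrow> x \<in> ?X - B)"
    by metis
  let ?D = "{q \<in> conditions. forces q (?X - B)}"
  let ?E = "insert ?D (\<Union>q\<in>?D. \<D> q)"
  have "countable ?D" by (rule countable_subset[OF _ countable_conditions[OF cnt]]) blast
  then have E: "countable ?E" using \<D> by (intro countable_insert countable_UN) auto
  have dE: "dense D'" if "D' \<in> ?E" for D' using that D \<D> by blast
  have "patterns \<in> refinements"
    unfolding refinements_def using admissible_patterns by (auto intro: exI[of _ "0::nat"])
  then obtain t where t: "(t, patterns) \<in> conditions" using conditions_nonempty[OF inf] by blast
  obtain \<FF> x where x0: "carries \<FF> x" "holds \<FF> x (t, patterns)" "x \<in> free_part G"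
      "\<forall>g\<in>carrier G. meets \<FF> (shift G g x) ?E"
    by (rule fully_generic_exists[OF cnt inf E dE t])
  note x = x0(1,3,4)
  have "x \<in> translates G (carrier G) B" using x(2) B(2) by (simp add: complete_section_def)
  then obtain g b where gb: "g \<in> carrier G" "b \<in> B" "x = shift G g b" by (auto simp: translates_def)
  have bs: "b \<in> ?X" using gb(2) B(2) by (auto simp: complete_section_def free_part_def)
  have b: "shift G (inv g) x = b"
    using gb bs shift_mult[of "inv g" g b] shift_one[OF bs] by simp
  have cb: "carries \<FF> b" using carries_shift[OF x(1), of "inv g"] gb b by simp
  have mb: "meets \<FF> b ?E" using bspec[OF x(3), of "inv g"] gb b by simp
  from meetsD[OF mb insertI1] obtain q where q: "q \<in> ?D" "holds \<FF> b q" by blast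
  have "\<D> q \<subseteq> ?E" using q(1) by blast
  with mb have "meets \<FF> b (\<D> q)" by (rule meets_subset)
  then have "b \<in> ?X - B" using \<D>[of q] q cb by blast
  then show False using gb by blast
qed

lemma refine_covers:
  assumes x: "locally_in (refine \<T> C t E r) x" "x \<in> topspace (shift_space G)"
    and C: "finite C" "C \<subseteq> carrier G" "\<one> \<in> C" and E: "finite E" "E \<subseteq> carrier G"
    and r: "r > 0" and t: "supp t \<subseteq> carrier G" and d: "d \<in> carrier G"
  shows "\<exists>e\<in>E. extends (shift G (e \<otimes> d) x) t"
proof -
  let ?W = "(\<lambda>e. e \<otimes> d) ` E"
  have "finite ?W" "?W \<subseteq> carrier G" using E d by auto
  then obtain V where V: "?W \<subseteq> V" "graph_on x V \<in> refine \<T> C t E r"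
    using x(1) unfolding locally_in_def by blast
  have "{e \<in> E. (C #> (e \<otimes> d)) \<inter> supp (graph_on x V) = {}} = {}"
  proof -
    have "e \<otimes> d \<in> (C #> (e \<otimes> d)) \<inter> V" if "e \<in> E" for e
      using that V(1) C(3) E d unfolding mem_r_coset Int_iff by (intro conjI bexI[of _ \<one>]) auto
    then show ?thesis by auto
  qed
  then have "\<not> r \<le> card {e \<in> E. (C #> (e \<otimes> d)) \<inter> supp (graph_on x V) = {}}"
    using r by (metis card.empty not_le)
  then obtain e where e: "e \<in> E" "translate t (e \<otimes> d) \<subseteq> graph_on x V"
    using V(2) d unfolding refine_def by blast
  then have "extends x (translate t (e \<otimes> d))" by (simp add: subset_graph_on)
  moreover have "e \<otimes> d \<in> carrier G" using e(1) E d by auto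
  ultimately show ?thesis using extends_shift[OF t _ x(2)] e(1) by blast
qed

text \<open>
  Let \<open>(t, \<T>)\<close> force membership in \<open>B\<close>. The refinement for \<open>t\<close> is applied to the inverses of the elements
  of \<open>F\<close>, because \<open>d \<cdot> x \<in> f \<cdot> B\<close> means \<open>f\<^sup>-\<^sup>1 d \<cdot> x \<in> B\<close>. The filter of a generic point of the refined subshift also
  contains \<open>\<T>\<close>, so \<open>(t, \<T>)\<close> holds at every translate of the point that extends \<open>t\<close>.
\<close>
theorem translates_trap:
  assumes cnt: "countable (carrier G)" and inf: "infinite (carrier G)"
    and B: "B \<in> borel_sets_of (shift_space G)" "complete_section G B"
  shows "\<exists>n::nat. \<forall>F. F \<subseteq> carrier G \<and> finite F \<and> n \<le> card F \<longrightarrow>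
           (\<exists>x. traps G (translates G F B) x)"
proof -
  obtain t \<T> where p: "(t, \<T>) \<in> conditions" "forces (t, \<T>) B"
    using section_forced[OF assms] by force
  obtain \<D> where \<D>: "countable \<D>" "\<And>D. D \<in> \<D> \<Longrightarrow> dense D"
    "\<And>\<FF> x. carries \<FF> x \<Longrightarrow> holds \<FF> x (t, \<T>) \<Longrightarrow> meets \<FF> x \<D> \<Longrightarrow> x \<in> B"
    using p(2) unfolding forces_def by metis
  obtain C n r where C: "finite C" "C \<subseteq> carrier G" "\<one> \<in> C" and r: "r > 0"
    and n: "\<And>F. F \<subseteq> carrier G \<Longrightarrow> finite F \<Longrightarrow> n \<le> card F \<Longrightarrow> \<exists>E\<subseteq>F. admissible (refine \<T> C t E r)"
    using admissible_refine[OF conditionsD(3)[OF p(1)] conditionsD(2)[OF p(1)]] by metis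
  have "\<exists>x. traps G (translates G F B) x" if F: "F \<subseteq> carrier G" "finite F" "n \<le> card F" for F
  proof -
    have "inj_on (\<lambda>g. inv g) F" using F(1) by (intro inj_onI) (metis inv_inv subsetD)
    then have "card ((\<lambda>g. inv g) ` F) = card F" by (rule card_image)
    then obtain E where E: "E \<subseteq> (\<lambda>g. inv g) ` F" "admissible (refine \<T> C t E r)"
      using n[of "(\<lambda>g. inv g) ` F"] F by auto
    have Ec: "finite E" "E \<subseteq> carrier G"
      using E(1) F finite_subset[OF E(1)] by auto
    let ?R = "refine \<T> C t E r"
    have R: "?R \<in> refinements"
      by (rule refinements_refine[OF conditionsD(1)[OF p(1)] C(1,2) conditionsD(2)[OF p(1)] Ec E(2)])
    obtain t0 where t0: "(t0, ?R) \<in> conditions" using conditions_nonempty[OF inf R] by blast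
    obtain \<FF> x where x: "carries \<FF> x" "holds \<FF> x (t0, ?R)" "x \<in> free_part G"
        "\<forall>g\<in>carrier G. meets \<FF> (shift G g x) \<D>"
      by (rule fully_generic_exists[OF cnt inf \<D>(1,2) t0])
    have xs: "x \<in> topspace (shift_space G)" using carriesD(1)[OF x(1)] .
    have R\<FF>: "?R \<in> \<FF>" using x(2) by (simp add: holds_def)
    have \<T>\<FF>: "\<T> \<in> \<FF>"
      by (rule carriesD(6)[OF x(1) R\<FF> conditionsD(1)[OF p(1)]]) (auto simp: refine_def)
    have "shift G d x \<in> translates G F B" if d: "d \<in> carrier G" for d
    proof -
      obtain e where e: "e \<in> E" "extends (shift G (e \<otimes> d) x) t"
        using refine_covers[OF carriesD(4)[OF x(1) R\<FF>] xs C Ec r conditionsD(6)[OF p(1)] d] by blast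
      obtain f where f: "f \<in> F" "e = inv f" using e(1) E(1) by blast
      have fc: "f \<in> carrier G" "e \<in> carrier G" using f F(1) by auto
      let ?y = "shift G (e \<otimes> d) x"
      have ed: "e \<otimes> d \<in> carrier G" using fc d by simp
      have "?y \<in> B"
        using \<D>(3)[OF carries_shift[OF x(1) ed] _ bspec[OF x(4) ed]] e(2) \<T>\<FF> by (simp add: holds_def)
      moreover have "shift G f ?y = shift G d x"
      proof -
        have "f \<otimes> (e \<otimes> d) = d" using fc f(2) d by (simp add: m_assoc[symmetric])
        then show ?thesis using shift_mult[OF fc(1) ed xs] by simp
      qed
      moreover have "shift G f ?y \<in> translates G F B" if "?y \<in> B"
        using that f(1) unfolding translates_def by blast
      ultimately show ?thesis by simp
    qed
    then have "orbit G (shift G) x \<subseteq> translates G F B" by (auto simp: orbit_def)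
    then show ?thesis using x(3) unfolding traps_def by blast
  qed
  then show ?thesis by blast
qed

end

theorem theorem1p20:
  fixes \<Gamma> :: "('a, 'b) monoid_scheme" and B :: "('a \<Rightarrow> bool) set"
  assumes "group \<Gamma>"
    and "countable (carrier \<Gamma>)"
    and "infinite (carrier \<Gamma>)"
    and "B \<in> borel_sets_of (shift_space \<Gamma>)"
    and "complete_section \<Gamma> B"
  shows "\<exists>n::nat. \<forall>F. F \<subseteq> carrier \<Gamma> \<and> finite F \<and> n \<le> card F \<longrightarrow>
           (\<exists>x. traps \<Gamma> (translates \<Gamma> F B) x)"
  using assms by (rule group.translates_trap)

end
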